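(* Let $K$ be an algebraically closed field and let $S$ be an $\mathbb{N}$-graded $K$-algebra that is a domain. Let $F_1,\dots,F_n$ be homogeneous elements of positive degree in $S$ that form a regular sequence in $S$ and generate a prime ideal $Q$ of $S$. Then the $K$-algebra homomorphism from the polynomial ring $K[X_1,\dots,X_n] \to S$ given by $X_i \mapsto F_i$ ($1 \le i \le n$) has the stable prime extension property.
   Context: All rings are commutative with identity. A ring homomorphism $R \to S$ has the prime extension property if for every prime ideal $P$ of $R$, $PS$ is prime in $S$ or $PS = S$; it has the stable prime extension property if for every $m \ge 0$, $R[Y_1,\dots,Y_m] \to S[Y_1,\dots,Y_m]$ has the prime extension property. *)

theory Defs
  imports "HOL-Library.Poly_Mapping" "HOL-Computational_Algebra.Polynomial"
begin

text \<open>Ideals relative to a carrier set A (a subring of the ambient commutative ring type).\<close>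

definition ideal_in :: "'a::comm_ring_1 set \<Rightarrow> 'a set \<Rightarrow> bool" where
  "ideal_in A I \<longleftrightarrow> I \<subseteq> A \<and> 0 \<in> I \<and> (\<forall>x\<in>I. \<forall>y\<in>I. x + y \<in> I)
      \<and> (\<forall>a\<in>A. \<forall>x\<in>I. a * x \<in> I)"

definition prime_ideal_in :: "'a::comm_ring_1 set \<Rightarrow> 'a set \<Rightarrow> bool" where
  "prime_ideal_in A P \<longleftrightarrow> ideal_in A P \<and> P \<noteq> A
      \<and> (\<forall>a\<in>A. \<forall>b\<in>A. a * b \<in> P \<longrightarrow> a \<in> P \<or> b \<in> P)"

definition ideal_gen_in :: "'a::comm_ring_1 set \<Rightarrow> 'a set \<Rightarrow> 'a set" where
  "ideal_gen_in A X = {x. \<exists>Y r. finite Y \<and> Y \<subseteq> X \<and> (\<forall>y\<in>Y. r y \<in> A)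
                               \<and> x = (\<Sum>y\<in>Y. r y * y)}"

text \<open>Polynomials in the variables indexed by 0..m-1 with coefficients in the set A:
  A[Y_1,...,Y_m] as a subring of the polynomial ring (nat =>0 nat) =>0 'a.\<close>
definition polys_over :: "'a::comm_ring_1 set \<Rightarrow> nat \<Rightarrow> ((nat \<Rightarrow>\<^sub>0 nat) \<Rightarrow>\<^sub>0 'a) set" where
  "polys_over A m = {p. (\<forall>mon\<in>Poly_Mapping.keys p. Poly_Mapping.keys mon \<subseteq> {..<m})
                        \<and> (\<forall>mon. Poly_Mapping.lookup p mon \<in> A)}"

definition prime_ext_prop :: "'a::comm_ring_1 set \<Rightarrow> 'b::comm_ring_1 set \<Rightarrow> ('a \<Rightarrow> 'b) \<Rightarrow> bool" where
  "prime_ext_prop A B f \<longleftrightarrow> (\<forall>P. prime_ideal_in A P \<longrightarrow>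
      (prime_ideal_in B (ideal_gen_in B (f ` P)) \<or> ideal_gen_in B (f ` P) = B))"

definition stable_prime_ext_prop :: "'a::comm_ring_1 set \<Rightarrow> ('a \<Rightarrow> 'b::comm_ring_1) \<Rightarrow> bool" where
  "stable_prime_ext_prop A f \<longleftrightarrow>
     (\<forall>m. prime_ext_prop (polys_over A m) (polys_over UNIV m) (Poly_Mapping.map f))"

definition alg_closed_field :: "'k::field itself \<Rightarrow> bool" where
  "alg_closed_field _ \<longleftrightarrow> (\<forall>p :: 'k poly. degree p \<ge> 1 \<longrightarrow> (\<exists>x. poly p x = 0))"

definition ring_hom_fun :: "('a::comm_ring_1 \<Rightarrow> 'b::comm_ring_1) \<Rightarrow> bool" where
  "ring_hom_fun f \<longleftrightarrow> f 1 = 1 \<and> (\<forall>x y. f (x + y) = f x + f y) \<and> (\<forall>x y. f (x * y) = f x * f y)"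

definition graded_algebra :: "('k::field \<Rightarrow> 'b::comm_ring_1) \<Rightarrow> (nat \<Rightarrow> 'b set) \<Rightarrow> bool" where
  "graded_algebra \<iota> G \<longleftrightarrow> ring_hom_fun \<iota>
     \<and> (\<forall>d. 0 \<in> G d \<and> (\<forall>x\<in>G d. \<forall>y\<in>G d. x + y \<in> G d) \<and> (\<forall>c. \<forall>x\<in>G d. \<iota> c * x \<in> G d))
     \<and> (\<forall>s. \<exists>!h :: nat \<Rightarrow> 'b. finite {d. h d \<noteq> 0} \<and> (\<forall>d. h d \<in> G d)
                               \<and> s = (\<Sum>d\<in>{d. h d \<noteq> 0}. h d))
     \<and> (\<forall>i j. \<forall>x\<in>G i. \<forall>y\<in>G j. x * y \<in> G (i + j))
     \<and> range \<iota> \<subseteq> G 0"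

definition regular_sequence :: "(nat \<Rightarrow> 'b::comm_ring_1) \<Rightarrow> nat \<Rightarrow> bool" where
  "regular_sequence F n \<longleftrightarrow>
     (\<forall>i<n. \<forall>x. x * F i \<in> ideal_gen_in UNIV (F ` {..<i}) \<longrightarrow> x \<in> ideal_gen_in UNIV (F ` {..<i}))
     \<and> ideal_gen_in UNIV (F ` {..<n}) \<noteq> UNIV"

text \<open>The K-algebra homomorphism K[X_1..X_n] \<rightarrow> S, X_(i+1) \<mapsto> F i (variables indexed from 0).\<close>
definition mpoly_eval :: "('k::field \<Rightarrow> 'b::comm_ring_1) \<Rightarrow> (nat \<Rightarrow> 'b) \<Rightarrow> ((nat \<Rightarrow>\<^sub>0 nat) \<Rightarrow>\<^sub>0 'k) \<Rightarrow> 'b" where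
  "mpoly_eval \<iota> F p = (\<Sum>mon\<in>Poly_Mapping.keys p.
       \<iota> (Poly_Mapping.lookup p mon) * (\<Prod>i\<in>Poly_Mapping.keys mon. F i ^ Poly_Mapping.lookup mon i))"

end

theory Submission
  imports Defs
begin

text \<open>Write \<open>R = K[X]\<close> and let \<open>P\<close> be a prime of \<open>R[Y]\<close>. Filter \<open>S[Y]/P S[Y]\<close> by the degree in \<open>S\<close>. As the
  relations \<open>F i = X i\<close> have leading forms \<open>F i\<close>, which form a regular sequence, the associated
  graded ring is \<open>R[Y]/P \<otimes>\<^sub>K S/Q\<close>, a tensor product of domains over an algebraically closed field, hence
  a domain. Concretely, two elements outside \<open>P S[Y]\<close> have leading forms \<open>\<Sum>j. r j * s j\<close> with some \<open>r j\<close>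
  outside \<open>P\<close> and with \<open>s j\<close> homogeneous and linearly independent modulo \<open>Q\<close>. By the Nullstellensatz
  there is a \<open>K\<close>-point of \<open>R[Y]/P\<close> at which the chosen coefficient of either element does not vanish.
  Specializing \<open>R[Y]\<close> to \<open>K\<close> there reduces the claim to the fact that \<open>Q\<close> is prime.\<close>

section \<open>A relative Nullstellensatz\<close>

text \<open>Elements of \<open>R\<close> count as degree 0 in the filtration, although X_i maps to
  the form F_i of positive degree. So a term r F_i u, with u homogeneous of degree d -
  \<open>\<delta> i\<close>, can be read again as (r X_i) u, which lies strictly below degree d.
  This is why the top degree matters only modulo \<open>Q\<close>, and why the s_j can be made
  independent modulo \<open>Q\<close> by a rewriting that terminates. Neither the associated graded
  ring nor a tensor product is formed. At a K-point with X-coordinates x_i, the extended ideal lands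
  in the ideal \<open>N\<close> of S generated by the F_i - x_i. Regularity is needed exactly to
  show that leading forms of elements of \<open>N\<close> lie in \<open>Q\<close>. One point must
  serve both factors of a product, and the product of their two chosen coefficients, again outside
  \<open>P\<close>, provides it. All rings are subsets of an ambient type. Quotients by a prime are
  replaced by membership in it, and division over a fraction field by pseudo-division.\<close>

definition subring_set :: "'a::comm_ring_1 set \<Rightarrow> bool" where
  "subring_set A \<longleftrightarrow> 1 \<in> A \<and> (\<forall>x\<in>A. \<forall>y\<in>A. x - y \<in> A \<and> x * y \<in> A)"

lemma subring_setD:
  assumes "subring_set A"
  shows "1 \<in> A" "0 \<in> A" "x \<in> A \<Longrightarrow> - x \<in> A"
    "x \<in> A \<Longrightarrow> y \<in> A \<Longrightarrow> x + y \<in> A" "x \<in> A \<Longrightarrow> y \<in> A \<Longrightarrow> x - y \<in> A"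
    "x \<in> A \<Longrightarrow> y \<in> A \<Longrightarrow> x * y \<in> A" "x \<in> A \<Longrightarrow> x ^ k \<in> A"
proof -
  show 1: "1 \<in> A" and d: "\<And>x y. x \<in> A \<Longrightarrow> y \<in> A \<Longrightarrow> x - y \<in> A"
    and m: "\<And>x y. x \<in> A \<Longrightarrow> y \<in> A \<Longrightarrow> x * y \<in> A"
    using assms by (auto simp: subring_set_def)
  show 0: "0 \<in> A" using d[OF 1 1] by simp
  show n: "\<And>x. x \<in> A \<Longrightarrow> - x \<in> A" using d[OF 0] by simp
  show "x \<in> A \<Longrightarrow> y \<in> A \<Longrightarrow> x + y \<in> A" using d[of x "- y"] n[of y] by simp
  show "x \<in> A \<Longrightarrow> x ^ k \<in> A" by (induction k) (auto intro: 1 m)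
qed

lemma subring_set_sum:
  assumes "subring_set A" "\<And>i. i \<in> I \<Longrightarrow> f i \<in> A"
  shows "sum f I \<in> A"
  using assms(2) by (induction I rule: infinite_finite_induct) (auto intro: subring_setD[OF assms(1)])

lemma ideal_in_minus: "subring_set A \<Longrightarrow> ideal_in A P \<Longrightarrow> x \<in> P \<Longrightarrow> - x \<in> P"
  unfolding ideal_in_def using subring_setD(1,3)[of A] by (metis mult_minus1)

lemma ideal_in_diff: "subring_set A \<Longrightarrow> ideal_in A P \<Longrightarrow> x \<in> P \<Longrightarrow> y \<in> P \<Longrightarrow> x - y \<in> P"
  using ideal_in_minus[of A P y] unfolding ideal_in_def by (metis add_uminus_conv_diff)

lemma ideal_in_sum:
  assumes "ideal_in A P" "\<And>i. i \<in> I \<Longrightarrow> f i \<in> P"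
  shows "sum f I \<in> P"
  using assms(2)
  by (induction I rule: infinite_finite_induct) (use assms(1) in \<open>auto simp: ideal_in_def\<close>)

lemma ideal_in_mult: "ideal_in A P \<Longrightarrow> a \<in> A \<Longrightarrow> x \<in> P \<Longrightarrow> a * x \<in> P"
  by (auto simp: ideal_in_def)

lemma prime_ideal_in_one_notin: "prime_ideal_in A P \<Longrightarrow> 1 \<notin> P"
  unfolding prime_ideal_in_def ideal_in_def by (metis mult.right_neutral subsetI subset_antisym)

lemma prime_ideal_in_power:
  assumes "subring_set A" "prime_ideal_in A P" "x \<in> A" "x \<notin> P"
  shows "x ^ k \<notin> P"
proof (induction k)
  case 0
  then show ?case using prime_ideal_in_one_notin[OF assms(2)] by simp
next
  case (Suc k)
  then show ?case using assms subring_setD(7)[OF assms(1,3), of k]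
    unfolding prime_ideal_in_def by (metis power_Suc)
qed

section \<open>Simple extensions of a subring and pseudo-division\<close>

definition polys_in :: "'a::comm_ring_1 set \<Rightarrow> 'a poly set" where
  "polys_in A = {p. \<forall>i. coeff p i \<in> A}"

definition adjoin :: "'a::comm_ring_1 set \<Rightarrow> 'a \<Rightarrow> 'a set" where
  "adjoin A c = (\<lambda>p. poly p c) ` polys_in A"

lemma subring_polys_in:
  assumes "subring_set A"
  shows "subring_set (polys_in A)"
  unfolding subring_set_def polys_in_def
  using subring_setD[OF assms]
  by (auto simp: coeff_mult coeff_1 intro!: subring_set_sum[OF assms])

lemma const_polys_in: "subring_set A \<Longrightarrow> a \<in> A \<Longrightarrow> [:a:] \<in> polys_in A"
  by (auto simp: polys_in_def coeff_pCons subring_setD(2) split: nat.split)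

lemma smult_polys_in: "subring_set A \<Longrightarrow> a \<in> A \<Longrightarrow> p \<in> polys_in A \<Longrightarrow> smult a p \<in> polys_in A"
  by (auto simp: polys_in_def subring_setD)

lemma monom_polys_in: "subring_set A \<Longrightarrow> a \<in> A \<Longrightarrow> monom a k \<in> polys_in A"
  by (auto simp: polys_in_def subring_setD)

lemma subring_adjoin:
  assumes "subring_set A"
  shows "subring_set (adjoin A c)"
proof -
  note S = subring_setD[OF subring_polys_in[OF assms]]
  show ?thesis
    unfolding subring_set_def adjoin_def
  proof (intro conjI ballI)
    show "1 \<in> (\<lambda>p. poly p c) ` polys_in A" using S(1) by (metis image_eqI poly_1)
  next
    fix x y assume "x \<in> (\<lambda>p. poly p c) ` polys_in A" "y \<in> (\<lambda>p. poly p c) ` polys_in A"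
    then obtain p q where "p \<in> polys_in A" "q \<in> polys_in A" "x = poly p c" "y = poly q c" by auto
    then show "x - y \<in> (\<lambda>p. poly p c) ` polys_in A" "x * y \<in> (\<lambda>p. poly p c) ` polys_in A"
      using S(5)[of p q] S(6)[of p q] by (metis image_eqI poly_diff, metis image_eqI poly_mult)
  qed
qed

lemma adjoin_superset: "subring_set A \<Longrightarrow> A \<subseteq> adjoin A c"
  unfolding adjoin_def using const_polys_in by force

lemma adjoin_gen: "subring_set A \<Longrightarrow> c \<in> adjoin A c"
  unfolding adjoin_def
  by (rule image_eqI[of _ _ "monom 1 1"]) (auto simp: poly_monom monom_polys_in subring_setD)

text \<open>The leading coefficient of \<open>g\<close> need not be invertible in \<open>A\<close>;
  multiplying the dividend by powers of it keeps quotient and remainder over \<open>A\<close>. If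
  the leading coefficient lies outside a prime, so do its powers, and the result is as good as a
  division over the fraction field.\<close>

lemma pseudo_division_polys_in:
  fixes g :: "'a::comm_ring_1 poly"
  assumes A: "subring_set A" and g: "g \<in> polys_in A"
  shows "f \<in> polys_in A \<Longrightarrow> \<exists>k. \<exists>q\<in>polys_in A. \<exists>r\<in>polys_in A.
    smult (lead_coeff g ^ k) f = q * g + r \<and> (r = 0 \<or> degree r < degree g)"
proof (induction "degree f" arbitrary: f rule: less_induct)
  case less
  note S = subring_setD[OF subring_polys_in[OF A]]
  have lg: "lead_coeff g \<in> A" and lf: "lead_coeff f \<in> A"
    using g less.prems by (auto simp: polys_in_def)
  consider "degree f < degree g" | "degree f \<ge> degree g" "degree f = 0" | "degree f \<ge> degree g" "degree f > 0"
    by linarith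
  then show ?case
  proof cases
    case 1
    then show ?thesis using less.prems S(2)
      by (intro exI[of _ 0] bexI[of _ 0] bexI[of _ f]) auto
  next
    \<comment> \<open>Both polynomials are constant. Cancelling leading terms would not lower
      \<open>degree f\<close> any further, so \<open>b * a = a * b + 0\<close> is used
      outright.\<close>
    case 2
    then obtain a b where "f = [:a:]" "g = [:b:]" by (metis degree_eq_zeroE le_zero_eq)
    then show ?thesis using less.prems S(2)
      by (intro exI[of _ 1] bexI[of _ f] bexI[of _ 0]) (auto simp: mult.commute)
  next
    case 3
    let ?m = "monom (lead_coeff f) (degree f - degree g)"
    let ?f = "smult (lead_coeff g) f - ?m * g"
    have m: "?m \<in> polys_in A" using monom_polys_in[OF A lf] .
    have f': "?f \<in> polys_in A"
      by (intro S smult_polys_in A lg less.prems m g)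
    have "degree (?m * g) \<le> degree ?m + degree g"
      by (rule degree_mult_le)
    also have "\<dots> \<le> degree f"
      using degree_monom_le[of "lead_coeff f" "degree f - degree g"] 3 by linarith
    finally have "degree ?f \<le> degree f"
      by (intro degree_diff_le degree_smult_le)
    moreover have "coeff ?f (degree f) = 0"
      using 3 by (simp add: coeff_monom_mult)
    ultimately have "degree ?f < degree f" using 3
      by (metis degree_0 le_neq_implies_less leading_coeff_0_iff)
    from less.hyps[OF this f'] obtain k q r where *: "q \<in> polys_in A" "r \<in> polys_in A"
      "smult (lead_coeff g ^ k) ?f = q * g + r" "r = 0 \<or> degree r < degree g" by blast
    have "smult (lead_coeff g ^ Suc k) f = (q + smult (lead_coeff g ^ k) ?m) * g + r"
      using *(3) by (simp add: smult_diff_right algebra_simps)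
    moreover have "q + smult (lead_coeff g ^ k) ?m \<in> polys_in A"
      by (intro S smult_polys_in A subring_setD(7)[OF A lg] m *(1))
    ultimately show ?thesis using *(2,4) by blast
  qed
qed

section \<open>Homomorphisms on a subring\<close>

definition hom_on :: "'a::comm_ring_1 set \<Rightarrow> ('a \<Rightarrow> 'b::comm_ring_1) \<Rightarrow> bool" where
  "hom_on A \<phi> \<longleftrightarrow> \<phi> 1 = 1 \<and> (\<forall>x\<in>A. \<forall>y\<in>A. \<phi> (x + y) = \<phi> x + \<phi> y \<and> \<phi> (x * y) = \<phi> x * \<phi> y)"

lemma hom_onD:
  assumes "hom_on A \<phi>"
  shows "\<phi> 1 = 1" "x \<in> A \<Longrightarrow> y \<in> A \<Longrightarrow> \<phi> (x + y) = \<phi> x + \<phi> y"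
    "x \<in> A \<Longrightarrow> y \<in> A \<Longrightarrow> \<phi> (x * y) = \<phi> x * \<phi> y"
  using assms by (auto simp: hom_on_def)

lemma hom_on_0: "subring_set A \<Longrightarrow> hom_on A \<phi> \<Longrightarrow> \<phi> 0 = 0"
  using hom_onD(2)[of A \<phi> 0 0] subring_setD(2)[of A] by simp

lemma hom_on_sum:
  assumes "subring_set A" "hom_on A \<phi>" "\<And>i. i \<in> I \<Longrightarrow> f i \<in> A"
  shows "\<phi> (sum f I) = (\<Sum>i\<in>I. \<phi> (f i))"
  using assms(3)
  by (induction I rule: infinite_finite_induct)
     (simp_all add: hom_on_0[OF assms(1,2)] hom_onD(2)[OF assms(2)] subring_set_sum[OF assms(1)])

lemma hom_on_map_poly:
  assumes A: "subring_set A" and h: "hom_on A \<phi>"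
  shows "hom_on (polys_in A) (map_poly \<phi>)"
  unfolding hom_on_def
proof (intro conjI ballI)
  note h0 = hom_on_0[OF A h]
  show "map_poly \<phi> 1 = 1" using hom_onD(1)[OF h] by (simp add: map_poly_1')
  fix p q assume pq: "p \<in> polys_in A" "q \<in> polys_in A"
  show "map_poly \<phi> (p + q) = map_poly \<phi> p + map_poly \<phi> q"
    using pq hom_onD(2)[OF h] by (intro poly_eqI) (auto simp: coeff_map_poly h0 polys_in_def)
  show "map_poly \<phi> (p * q) = map_poly \<phi> p * map_poly \<phi> q"
  proof (rule poly_eqI)
    fix k
    have "\<phi> (\<Sum>i\<le>k. coeff p i * coeff q (k - i)) = (\<Sum>i\<le>k. \<phi> (coeff p i * coeff q (k - i)))"
      using pq by (intro hom_on_sum[OF A h]) (auto simp: polys_in_def subring_setD[OF A])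
    also have "\<dots> = (\<Sum>i\<le>k. \<phi> (coeff p i) * \<phi> (coeff q (k - i)))"
      using pq hom_onD(3)[OF h] by (intro sum.cong) (auto simp: polys_in_def)
    finally show "coeff (map_poly \<phi> (p * q)) k = coeff (map_poly \<phi> p * map_poly \<phi> q) k"
      by (simp add: coeff_map_poly h0 coeff_mult)
  qed
qed

text \<open>Over a finite field, 1 plus the product of all X - a would be a nonconstant polynomial
  without a root.\<close>

lemma alg_closed_field_infinite:
  assumes "alg_closed_field TYPE('k::field)"
  shows "infinite (UNIV :: 'k set)"
proof
  assume fin: "finite (UNIV :: 'k set)"
  define p :: "'k poly" where "p = (\<Prod>a\<in>UNIV. [:- a, 1:]) + 1"
  have "poly p x = 1" for x
    using fin unfolding p_def poly_add poly_prod
    by (subst prod.remove[of UNIV x]) auto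
  moreover have "degree p \<ge> 1"
  proof -
    have "degree (\<Prod>a\<in>(UNIV :: 'k set). [:- a, 1:]) = card (UNIV :: 'k set)"
      by (subst degree_prod_eq_sum_degree) auto
    moreover have "card (UNIV :: 'k set) > 0" using fin by (simp add: card_gt_0_iff)
    ultimately show ?thesis unfolding p_def
      by (subst degree_add_eq_left) auto
  qed
  ultimately show False using assms unfolding alg_closed_field_def by (metis zero_neq_one)
qed

section \<open>Extending a K-valued homomorphism by one generator\<close>

locale prime_of_adjoin =
  fixes A :: "'a::comm_ring_1 set" and c :: 'a and P :: "'a set"
  assumes subring: "subring_set A" and prime: "prime_ideal_in (adjoin A c) P"
begin

lemma idl: "ideal_in (adjoin A c) P"
  using prime by (simp add: prime_ideal_in_def)

lemma idl_add: "x \<in> P \<Longrightarrow> y \<in> P \<Longrightarrow> x + y \<in> P" and idl_0: "0 \<in> P"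
  using idl by (auto simp: ideal_in_def)

lemma idl_diff: "x \<in> P \<Longrightarrow> y \<in> P \<Longrightarrow> x - y \<in> P"
  using ideal_in_diff[OF subring_adjoin[OF subring] idl] .

lemma prime_mult: "x \<in> adjoin A c \<Longrightarrow> y \<in> adjoin A c \<Longrightarrow> x * y \<in> P \<longleftrightarrow> x \<in> P \<or> y \<in> P"
  using prime idl unfolding prime_ideal_in_def ideal_in_def by (metis mult.commute)

lemma A_sub: "x \<in> A \<Longrightarrow> x \<in> adjoin A c"
  using adjoin_superset[OF subring] by blast

lemma poly_in: "p \<in> polys_in A \<Longrightarrow> poly p c \<in> adjoin A c"
  by (auto simp: adjoin_def)

lemmas S = subring_setD[OF subring_polys_in[OF subring]]

lemma prime_coeffs:
  assumes "p \<in> polys_in A" "\<And>i. coeff p i \<in> P"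
  shows "poly p c \<in> P"
  unfolding poly_altdef
  by (rule ideal_in_sum[OF idl], subst mult.commute, rule ideal_in_mult[OF idl])
     (use assms subring_setD(7)[OF subring_adjoin[OF subring] adjoin_gen[OF subring]] in auto)

text \<open>A representative of the reduction modulo \<open>P\<close>: with the coefficients in
  \<open>P\<close> deleted, the degree is the degree modulo \<open>P\<close>, and a nonzero result
  has its leading coefficient outside \<open>P\<close>.\<close>

definition nrm :: "'a poly \<Rightarrow> 'a poly" where
  "nrm p = map_poly (\<lambda>x. if x \<in> P then 0 else x) p"

lemma coeff_nrm: "coeff (nrm p) i = (if coeff p i \<in> P then 0 else coeff p i)"
  by (simp add: nrm_def coeff_map_poly)

lemma nrm_in: "p \<in> polys_in A \<Longrightarrow> nrm p \<in> polys_in A"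
  by (auto simp: polys_in_def coeff_nrm subring_setD(2)[OF subring])

lemma degree_nrm: "degree (nrm p) \<le> degree p"
  by (rule degree_le) (auto simp: coeff_nrm coeff_eq_0)

lemma lead_coeff_nrm: "nrm p \<noteq> 0 \<Longrightarrow> lead_coeff (nrm p) \<notin> P"
  by (metis coeff_nrm leading_coeff_0_iff)

lemma nrm_eq_0: "nrm p = 0 \<longleftrightarrow> (\<forall>i. coeff p i \<in> P)"
  by (auto simp: poly_eq_iff coeff_nrm idl_0)

lemma poly_diff_nrm: "p \<in> polys_in A \<Longrightarrow> poly (p - nrm p) c \<in> P"
  by (rule prime_coeffs) (auto simp: coeff_nrm idl_0 intro: S nrm_in)

lemma poly_nrm_iff: "p \<in> polys_in A \<Longrightarrow> poly (nrm p) c \<in> P \<longleftrightarrow> poly p c \<in> P"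
  using poly_diff_nrm[of p] idl_diff[of "poly p c" "poly (p - nrm p) c"] idl_add[of "poly (p - nrm p) c" "poly (nrm p) c"]
  by auto

text \<open>The kernel of evaluation at \<open>c\<close> from A[X] to A[c]/P.\<close>

definition rel :: "'a poly set" where
  "rel = {p \<in> polys_in A. poly p c \<in> P}"

lemma relD: "p \<in> rel \<Longrightarrow> p \<in> polys_in A" "p \<in> rel \<Longrightarrow> poly p c \<in> P"
  by (auto simp: rel_def)

lemma rel_intros:
  "p \<in> rel \<Longrightarrow> q \<in> rel \<Longrightarrow> p + q \<in> rel" "p \<in> rel \<Longrightarrow> q \<in> rel \<Longrightarrow> p - q \<in> rel"
  "p \<in> polys_in A \<Longrightarrow> q \<in> rel \<Longrightarrow> p * q \<in> rel"
  "p \<in> polys_in A \<Longrightarrow> p - nrm p \<in> rel" "p \<in> polys_in A \<Longrightarrow> nrm p - p \<in> rel"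
  "p \<in> rel \<Longrightarrow> nrm p \<in> rel"
proof -
  show add: "p \<in> rel \<Longrightarrow> q \<in> rel \<Longrightarrow> p + q \<in> rel" for p q
    by (auto simp: rel_def intro: S idl_add)
  show diff: "p \<in> rel \<Longrightarrow> q \<in> rel \<Longrightarrow> p - q \<in> rel" for p q
    by (auto simp: rel_def intro: S idl_diff)
  show "p \<in> polys_in A \<Longrightarrow> q \<in> rel \<Longrightarrow> p * q \<in> rel"
    by (auto simp: rel_def intro: S ideal_in_mult[OF idl] poly_in)
  show pn: "p - nrm p \<in> rel" if "p \<in> polys_in A" for p
    using that poly_diff_nrm[OF that] S(5)[OF that nrm_in[OF that]] by (simp add: rel_def)
  show "p \<in> polys_in A \<Longrightarrow> nrm p - p \<in> rel"
    using diff[of 0 "p - nrm p"] pn by (simp add: rel_def idl_0 S(2))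
  show "p \<in> rel \<Longrightarrow> nrm p \<in> rel"
    by (auto simp: rel_def poly_nrm_iff intro: nrm_in)
qed

text \<open>If \<open>c\<close> is algebraic over \<open>A\<close> modulo \<open>P\<close>, then modulo \<open>P\<close> the polynomial \<open>g\<close> of least degree
  is irreducible over the fraction field, so it is coprime to every \<open>u\<close> that does not vanish at \<open>c\<close>.\<close>

lemma bezout_constant:
  assumes g: "g \<in> rel" "lead_coeff g \<notin> P"
    and gmin: "\<And>p. p \<in> rel \<Longrightarrow> lead_coeff p \<notin> P \<Longrightarrow> degree g \<le> degree p"
    and u: "u \<in> polys_in A" "poly u c \<notin> P"
  shows "\<exists>a\<in>A - P. \<exists>\<alpha>\<in>polys_in A. \<exists>h\<in>rel. [:a:] = \<alpha> * u + h"
proof -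
  \<comment> \<open>Candidates for the constant sought: combinations of \<open>u\<close> and a
    relation that do not vanish at \<open>c\<close> modulo \<open>P\<close>. A member of least
    degree will turn out to be constant.\<close>
  define W where "W = {w \<in> polys_in A. lead_coeff w \<notin> P \<and> poly w c \<notin> P \<and> (\<exists>\<alpha>\<in>polys_in A. \<exists>h\<in>rel. w = \<alpha> * u + h)}"
  have WI: "nrm w \<in> W" if w: "w \<in> polys_in A" "poly w c \<notin> P" "\<alpha> \<in> polys_in A" "h \<in> rel" "w = \<alpha> * u + h" for w \<alpha> h
  proof -
    have "nrm w \<noteq> 0" using w(2) nrm_eq_0 prime_coeffs[OF w(1)] by blast
    moreover have "nrm w = \<alpha> * u + (h + (nrm w - w))" using w(5) by simp
    moreover have "h + (nrm w - w) \<in> rel" using w by (intro rel_intros)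
    ultimately show ?thesis
      unfolding W_def using w lead_coeff_nrm poly_nrm_iff nrm_in by blast
  qed
  have "nrm u \<in> W" using WI[of u 1 0] u S(1,2) idl_0 by (auto simp: rel_def)
  from ex_has_least_nat[of "\<lambda>w. w \<in> W", OF this, of degree] obtain w where w: "w \<in> W"
    and wmin: "\<And>v. v \<in> W \<Longrightarrow> degree w \<le> degree v" by blast
  have gA: "g \<in> polys_in A" "lead_coeff g \<in> A" using g(1) by (auto simp: rel_def polys_in_def)
  from w obtain \<alpha> h where wA: "w \<in> polys_in A" "lead_coeff w \<in> A" and lw: "lead_coeff w \<notin> P"
    and wP: "poly w c \<notin> P" and \<alpha>: "\<alpha> \<in> polys_in A" "h \<in> rel" "w = \<alpha> * u + h"
    by (auto simp: W_def polys_in_def)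
  have pow: "lead_coeff v ^ k \<notin> P" "lead_coeff v ^ k \<in> A"
    if "v \<in> polys_in A" "lead_coeff v \<notin> P" for v k
  proof -
    have "lead_coeff v \<in> A" using that(1) by (auto simp: polys_in_def)
    then show "lead_coeff v ^ k \<notin> P" "lead_coeff v ^ k \<in> A"
      using prime_ideal_in_power[OF subring_adjoin[OF subring] prime A_sub that(2)] subring_setD(7)[OF subring]
      by auto
  qed
  \<comment> \<open>Otherwise the remainder of \<open>w\<close> on division by \<open>g\<close>,
    still nonzero at \<open>c\<close>, would normalize to a member of \<open>W\<close> of smaller
    degree.\<close>
  have small: "degree w < degree g"
  proof (rule ccontr)
    assume "\<not> degree w < degree g"
    obtain k q r where *: "q \<in> polys_in A" "r \<in> polys_in A"
      "smult (lead_coeff g ^ k) w = q * g + r" "r = 0 \<or> degree r < degree g"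
      using pseudo_division_polys_in[OF subring gA(1) wA(1)] by blast
    let ?l = "lead_coeff g ^ k"
    have "?l * poly w c \<notin> P"
      using prime_mult[of ?l "poly w c"] pow[OF gA(1) g(2), of k] wP poly_in[OF wA(1)] A_sub by blast
    moreover have "?l * poly w c = poly (q * g) c + poly r c"
      using arg_cong[OF *(3), of "\<lambda>p. poly p c"] by simp
    moreover have qg: "q * g \<in> rel" using *(1) g(1) by (rule rel_intros)
    ultimately have rP: "poly r c \<notin> P" using idl_add relD(2) by metis
    have "r = (smult ?l \<alpha>) * u + ([:?l:] * h - q * g)"
      using *(3) \<alpha>(3) by (simp add: smult_add_right algebra_simps)
    moreover have "[:?l:] * h - q * g \<in> rel"
      by (intro rel_intros qg const_polys_in[OF subring] pow[OF gA(1) g(2)] \<alpha>)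
    moreover have "smult ?l \<alpha> \<in> polys_in A" using smult_polys_in[OF subring pow(2)[OF gA(1) g(2)] \<alpha>(1)] .
    ultimately have "nrm r \<in> W" using WI[OF *(2) rP] by blast
    then have "degree w \<le> degree (nrm r)" by (rule wmin)
    moreover have "r \<noteq> 0" using rP idl_0 by auto
    ultimately show False using \<open>\<not> degree w < degree g\<close> *(4) degree_nrm[of r] by linarith
  qed
  \<comment> \<open>Now \<open>g\<close> is divided by \<open>w\<close>. A remainder nonzero at
    \<open>c\<close> would contradict the choice of \<open>w\<close>; one that vanishes at
    \<open>c\<close> is a relation of degree below that of \<open>g\<close>, so all its coefficients
    lie in \<open>P\<close>. Hence a multiple of \<open>g\<close> equals \<open>q * w\<close> modulo
    \<open>P\<close>.\<close>
  obtain k q r where *: "q \<in> polys_in A" "r \<in> polys_in A"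
    "smult (lead_coeff w ^ k) g = q * w + r" "r = 0 \<or> degree r < degree w"
    using pseudo_division_polys_in[OF subring wA(1) gA(1)] by blast
  let ?l = "lead_coeff w ^ k"
  have lg: "smult ?l g \<in> rel"
    using rel_intros(3)[OF const_polys_in[OF subring pow(2)[OF wA(1) lw]] g(1), of k] by simp
  have rP: "poly r c \<in> P"
  proof (rule ccontr)
    assume rP: "poly r c \<notin> P"
    have "r = (- q * \<alpha>) * u + (smult ?l g - q * h)"
      using *(3) \<alpha>(3) by (simp add: algebra_simps)
    moreover have "- q * \<alpha> \<in> polys_in A" "smult ?l g - q * h \<in> rel"
      by (intro S * \<alpha>, intro rel_intros lg * \<alpha>)
    ultimately have "nrm r \<in> W" using WI[OF *(2) rP] by blast
    then have "degree w \<le> degree (nrm r)" by (rule wmin)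
    moreover have "r \<noteq> 0" using rP idl_0 by auto
    ultimately show False using *(4) degree_nrm[of r] by linarith
  qed
  have nr: "nrm r = 0"
  proof (rule ccontr)
    assume nz: "nrm r \<noteq> 0"
    have "nrm r \<in> rel" using *(2) rP by (intro rel_intros) (auto simp: rel_def)
    then have "degree g \<le> degree (nrm r)" using gmin lead_coeff_nrm[OF nz] by blast
    moreover have "r \<noteq> 0" using nz by (auto simp: nrm_def)
    ultimately show False using small *(4) degree_nrm[of r] by linarith
  qed
  \<comment> \<open>Since \<open>w\<close> does not vanish at \<open>c\<close>, primality makes
    \<open>q\<close> a relation. Its normal form then has degree at least \<open>degree g\<close>,
    which leaves no room for a positive degree of \<open>w\<close>.\<close>
  have "poly q c * poly w c \<in> P"
    using idl_diff[OF relD(2)[OF lg] rP] arg_cong[OF *(3), of "\<lambda>p. poly p c"] by simp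
  then have qP: "poly q c \<in> P" using prime_mult poly_in * wA wP by blast
  have in_P: "coeff ((q - nrm q) * w) i \<in> P" for i
    unfolding coeff_mult
    by (rule ideal_in_sum[OF idl], subst mult.commute, rule ideal_in_mult[OF idl])
       (use wA in \<open>auto simp: coeff_nrm idl_0 polys_in_def A_sub\<close>)
  have coeff_lg: "coeff (nrm q * w) i - ?l * coeff g i \<in> P" for i
  proof -
    have "coeff (nrm q * w) i = ?l * coeff g i - coeff r i - coeff ((q - nrm q) * w) i"
      using arg_cong[OF *(3), of "\<lambda>p. coeff p i"] by (simp add: left_diff_distrib)
    then have "coeff (nrm q * w) i - ?l * coeff g i = 0 - coeff r i - coeff ((q - nrm q) * w) i"
      by simp
    then show ?thesis using in_P idl_diff idl_0 nr nrm_eq_0 by metis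
  qed
  have nq: "nrm q \<noteq> 0"
  proof
    assume "nrm q = 0"
    then have "0 - ?l * lead_coeff g \<in> P" using coeff_lg[of "degree g"] by simp
    then have "?l * lead_coeff g \<in> P" using idl_diff[OF idl_0, of "0 - ?l * lead_coeff g"] by simp
    then show False using prime_mult pow[OF wA(1) lw] g(2) gA(2) A_sub by blast
  qed
  have "nrm q \<in> rel" using *(1) qP by (intro rel_intros) (auto simp: rel_def)
  then have dq: "degree g \<le> degree (nrm q)" using gmin lead_coeff_nrm[OF nq] by blast
  have "degree w = 0"
  proof (rule ccontr)
    assume "degree w \<noteq> 0"
    then have "coeff g (degree (nrm q) + degree w) = 0" using dq by (intro coeff_eq_0) simp
    then have "lead_coeff (nrm q) * lead_coeff w \<in> P"
      using coeff_lg[of "degree (nrm q) + degree w"] by (simp add: coeff_mult_degree_sum)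
    moreover have "lead_coeff (nrm q) \<in> A" using nrm_in[OF *(1)] by (auto simp: polys_in_def)
    ultimately show False using prime_mult lead_coeff_nrm[OF nq] lw wA(2) A_sub by blast
  qed
  then obtain a where "w = [:a:]" by (metis degree_eq_zeroE)
  then show ?thesis using \<alpha> lw wA(2) by (intro bexI[of _ a] bexI[of _ \<alpha>] bexI[of _ h]) auto
qed

text \<open>An admissible value for \<open>c\<close> is a common zero of all specialized relations.
  The element \<open>a\<close> collects the leading coefficients and Bezout constants that must
  survive \<open>\<phi>\<close> for such a zero to exist and to avoid the zeros of
  \<open>u\<close>.\<close>

lemma specialization_root:
  fixes K :: "'k::field itself"
  assumes K: "alg_closed_field K" and u: "u \<in> polys_in A" "poly u c \<notin> P"
  shows "\<exists>a\<in>A - P. \<forall>\<phi> :: 'a \<Rightarrow> 'k. hom_on A \<phi> \<longrightarrow> (\<forall>x\<in>P \<inter> A. \<phi> x = 0) \<longrightarrow> \<phi> a \<noteq> 0 \<longrightarrow>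
    (\<exists>\<xi>. (\<forall>p\<in>rel. poly (map_poly \<phi> p) \<xi> = 0) \<and> poly (map_poly \<phi> u) \<xi> \<noteq> 0)"
proof (cases "\<exists>g\<in>rel. lead_coeff g \<notin> P")
  \<comment> \<open>\<open>c\<close> is transcendental modulo \<open>P\<close>: all coefficients of
    relations lie in \<open>P\<close>, so relations specialize to 0 and \<open>\<xi>\<close> only
    has to avoid the finitely many roots of the specialized \<open>u\<close>.\<close>
  case False
  have coP: "coeff p i \<in> P" if "p \<in> rel" for p i
    using False rel_intros(6)[OF that] lead_coeff_nrm[of p] nrm_eq_0 by blast
  have nu: "nrm u \<noteq> 0" using u nrm_eq_0 prime_coeffs by blast
  have lu: "lead_coeff (nrm u) \<in> A" using nrm_in[OF u(1)] by (auto simp: polys_in_def)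
  show ?thesis
  proof (intro bexI[of _ "lead_coeff (nrm u)"] allI impI)
    fix \<phi> :: "'a \<Rightarrow> 'k" assume h: "hom_on A \<phi>" and k: "\<forall>x\<in>P \<inter> A. \<phi> x = 0" and nz: "\<phi> (lead_coeff (nrm u)) \<noteq> 0"
    note h0 = hom_on_0[OF subring h]
    have ker: "map_poly \<phi> p = 0" if "p \<in> rel" for p
      using that coP[OF that] k by (auto simp: poly_eq_iff coeff_map_poly h0 rel_def polys_in_def)
    have "coeff (map_poly \<phi> u) (degree (nrm u)) \<noteq> 0"
      using nz h0 by (auto simp: coeff_map_poly h0 coeff_nrm split: if_splits)
    then have "map_poly \<phi> u \<noteq> 0" by auto
    then have "finite {x. poly (map_poly \<phi> u) x = 0}" by (rule poly_roots_finite)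
    moreover have "infinite (UNIV :: 'k set)"
      using K alg_closed_field_infinite by (auto simp: alg_closed_field_def)
    ultimately obtain \<xi> where "poly (map_poly \<phi> u) \<xi> \<noteq> 0"
      using ex_new_if_finite by fastforce
    then show "\<exists>\<xi>. (\<forall>p\<in>rel. poly (map_poly \<phi> p) \<xi> = 0) \<and> poly (map_poly \<phi> u) \<xi> \<noteq> 0"
      using ker by (intro exI[of _ \<xi>]) auto
  qed (use lu lead_coeff_nrm[OF nu] in auto)
next
  \<comment> \<open>\<open>c\<close> is algebraic modulo \<open>P\<close>: \<open>\<xi>\<close> will
    be a root of the specialized minimal relation \<open>g\<close>.\<close>
  case True
  then obtain g0 where "g0 \<in> rel \<and> lead_coeff g0 \<notin> P" by blast
  from ex_has_least_nat[of "\<lambda>g. g \<in> rel \<and> lead_coeff g \<notin> P", OF this, of degree]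
  obtain g where g: "g \<in> rel" "lead_coeff g \<notin> P"
    and gmin: "\<And>p. p \<in> rel \<Longrightarrow> lead_coeff p \<notin> P \<Longrightarrow> degree g \<le> degree p" by metis
  obtain a \<alpha> h where a: "a \<in> A - P" "\<alpha> \<in> polys_in A" "h \<in> rel" "[:a:] = \<alpha> * u + h"
    using bezout_constant[OF g gmin u] by blast
  have gA: "g \<in> polys_in A" "lead_coeff g \<in> A" using g(1) by (auto simp: rel_def polys_in_def)
  show ?thesis
  proof (intro bexI[of _ "a * lead_coeff g"] allI impI)
    show "a * lead_coeff g \<in> A - P"
      using a(1) gA g(2) prime_mult A_sub subring_setD(6)[OF subring] by auto
    fix \<phi> :: "'a \<Rightarrow> 'k" assume h: "hom_on A \<phi>" and k: "\<forall>x\<in>P \<inter> A. \<phi> x = 0"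
      and nz0: "\<phi> (a * lead_coeff g) \<noteq> 0"
    note h0 = hom_on_0[OF subring h]
    note H = hom_onD[OF hom_on_map_poly[OF subring h]]
    have nz: "\<phi> a \<noteq> 0" "\<phi> (lead_coeff g) \<noteq> 0"
      using nz0 a(1) gA(2) hom_onD(3)[OF h, of a "lead_coeff g"] by auto
    \<comment> \<open>A constant relation is its own value at \<open>c\<close> and so lies in
      \<open>P\<close>, unlike the leading coefficient of \<open>g\<close>. With its leading
      coefficient preserved by \<open>\<phi>\<close>, the specialized \<open>g\<close> has positive
      degree and hence a root.\<close>
    have dg: "degree g \<noteq> 0"
    proof
      assume "degree g = 0"
      then obtain b where "g = [:b:]" by (metis degree_eq_zeroE)
      then show False using g by (auto simp: rel_def)
    qed
    have "coeff (map_poly \<phi> g) (degree g) \<noteq> 0" using nz by (simp add: coeff_map_poly h0)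
    then have "degree (map_poly \<phi> g) \<ge> 1" using dg le_degree[of "map_poly \<phi> g" "degree g"] by linarith
    then obtain \<xi> where \<xi>: "poly (map_poly \<phi> g) \<xi> = 0" using K by (auto simp: alg_closed_field_def)
    \<comment> \<open>By minimality of \<open>g\<close>, pseudo-division of a relation by
      \<open>g\<close> leaves a remainder with all coefficients in \<open>P\<close>. After
      specialization, a nonzero scalar times \<open>p\<close> is thus a multiple of
      \<open>g\<close>.\<close>
    have ker: "poly (map_poly \<phi> p) \<xi> = 0" if p: "p \<in> rel" for p
    proof -
      obtain k q r where *: "q \<in> polys_in A" "r \<in> polys_in A"
        "smult (lead_coeff g ^ k) p = q * g + r" "r = 0 \<or> degree r < degree g"
        using pseudo_division_polys_in[OF subring gA(1) relD(1)[OF p]] by blast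
      have lk: "[:lead_coeff g ^ k:] \<in> polys_in A"
        using const_polys_in[OF subring subring_setD(7)[OF subring gA(2)]] .
      have "r = [:lead_coeff g ^ k:] * p - q * g" using *(3) by simp
      also have "\<dots> \<in> rel" by (intro rel_intros lk p * g)
      finally have nr: "nrm r \<in> rel" by (rule rel_intros)
      have "nrm r = 0"
      proof (rule ccontr)
        assume nz: "nrm r \<noteq> 0"
        then have "degree g \<le> degree (nrm r)" using gmin nr lead_coeff_nrm[OF nz] by blast
        moreover have "r \<noteq> 0" using nz by (auto simp: nrm_def)
        ultimately show False using *(4) degree_nrm[of r] by linarith
      qed
      then have "map_poly \<phi> r = 0"
        using *(2) k nrm_eq_0[of r] by (auto simp: poly_eq_iff coeff_map_poly h0 polys_in_def)
      moreover have "map_poly \<phi> ([:lead_coeff g ^ k:] * p) = map_poly \<phi> (q * g + r)"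
        using *(3) by simp
      moreover have "\<phi> (lead_coeff g ^ k) = \<phi> (lead_coeff g) ^ k"
        using gA(2) by (induction k) (auto simp: hom_onD[OF h] subring_setD(7)[OF subring])
      ultimately have "[:\<phi> (lead_coeff g) ^ k:] * map_poly \<phi> p = map_poly \<phi> q * map_poly \<phi> g"
        using * gA lk relD(1)[OF p] S(6)[OF *(1) gA(1)]
        by (simp add: H map_poly_pCons h0 del: mult_pCons_left)
      from arg_cong[OF this, of "\<lambda>p. poly p \<xi>"]
      have "\<phi> (lead_coeff g) ^ k * poly (map_poly \<phi> p) \<xi> = 0" using \<xi> by simp
      then show ?thesis using nz by simp
    qed
    have "map_poly \<phi> [:a:] = map_poly \<phi> \<alpha> * map_poly \<phi> u + map_poly \<phi> h"
      unfolding a(4) using a u relD(1)[OF a(3)] S(6)[OF a(2) u(1)] by (simp add: H)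
    then have "\<phi> a = poly (map_poly \<phi> \<alpha>) \<xi> * poly (map_poly \<phi> u) \<xi> + poly (map_poly \<phi> h) \<xi>"
      by (metis h0 map_poly_pCons map_poly_0 poly_add poly_mult poly_pCons poly_0 mult_zero_right add_0_right)
    then have "poly (map_poly \<phi> u) \<xi> \<noteq> 0" using nz ker[OF a(3)] by auto
    then show "\<exists>\<xi>. (\<forall>p\<in>rel. poly (map_poly \<phi> p) \<xi> = 0) \<and> poly (map_poly \<phi> u) \<xi> \<noteq> 0"
      using ker by blast
  qed
qed

lemma hom_extension:
  fixes K :: "'k::field itself"
  assumes K: "alg_closed_field K" and u: "u \<in> adjoin A c - P"
  shows "\<exists>a\<in>A - P. \<forall>\<phi> :: 'a \<Rightarrow> 'k. hom_on A \<phi> \<longrightarrow> (\<forall>x\<in>P \<inter> A. \<phi> x = 0) \<longrightarrow> \<phi> a \<noteq> 0 \<longrightarrow>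
    (\<exists>\<psi>. hom_on (adjoin A c) \<psi> \<and> (\<forall>x\<in>A. \<psi> x = \<phi> x) \<and> (\<forall>x\<in>P. \<psi> x = 0) \<and> \<psi> u \<noteq> 0)"
proof -
  obtain U where U: "U \<in> polys_in A" "u = poly U c" "poly U c \<notin> P" using u by (auto simp: adjoin_def)
  from specialization_root[OF K U(1,3)] obtain a where a: "a \<in> A - P"
    and ext: "\<And>\<phi> :: 'a \<Rightarrow> 'k. hom_on A \<phi> \<Longrightarrow> (\<forall>x\<in>P \<inter> A. \<phi> x = 0) \<Longrightarrow> \<phi> a \<noteq> 0 \<Longrightarrow>
      (\<exists>\<xi>. (\<forall>p\<in>rel. poly (map_poly \<phi> p) \<xi> = 0) \<and> poly (map_poly \<phi> U) \<xi> \<noteq> 0)" by blast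
  show ?thesis
  proof (intro bexI[OF _ a] allI impI)
    fix \<phi> :: "'a \<Rightarrow> 'k" assume h: "hom_on A \<phi>" and k: "\<forall>x\<in>P \<inter> A. \<phi> x = 0" and nz: "\<phi> a \<noteq> 0"
    obtain \<xi> where ker: "\<And>p. p \<in> rel \<Longrightarrow> poly (map_poly \<phi> p) \<xi> = 0" and nu: "poly (map_poly \<phi> U) \<xi> \<noteq> 0"
      using ext[OF h k nz] by blast
    note H = hom_onD[OF hom_on_map_poly[OF subring h]]
    \<comment> \<open>The value is computed from an arbitrary polynomial representing
      \<open>x\<close>. Two representatives differ by a relation, and relations vanish at
      \<open>\<xi>\<close>, so the choice is immaterial.\<close>
    define \<psi> where "\<psi> x = poly (map_poly \<phi> (SOME p. p \<in> polys_in A \<and> poly p c = x)) \<xi>" for x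
    have \<psi>: "\<psi> (poly p c) = poly (map_poly \<phi> p) \<xi>" if p: "p \<in> polys_in A" for p
    proof -
      let ?q = "SOME q. q \<in> polys_in A \<and> poly q c = poly p c"
      have q: "?q \<in> polys_in A \<and> poly ?q c = poly p c" by (rule someI[of _ p]) (simp add: p)
      then have "?q - p \<in> rel" using p S(5) idl_0 by (simp add: rel_def)
      then have "poly (map_poly \<phi> (?q - p)) \<xi> = 0" by (rule ker)
      moreover have "map_poly \<phi> ?q = map_poly \<phi> (?q - p) + map_poly \<phi> p"
        using H(2)[of "?q - p" p] q p S(5) by simp
      ultimately show ?thesis by (simp add: \<psi>_def)
    qed
    have "hom_on (adjoin A c) \<psi>"
      unfolding hom_on_def
    proof (intro conjI ballI)
      show "\<psi> 1 = 1" using \<psi>[OF S(1)] H(1) by simp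
      fix x y assume "x \<in> adjoin A c" "y \<in> adjoin A c"
      then obtain p q where pq: "p \<in> polys_in A" "q \<in> polys_in A" "x = poly p c" "y = poly q c"
        by (auto simp: adjoin_def)
      show "\<psi> (x + y) = \<psi> x + \<psi> y" using \<psi>[OF S(4)[OF pq(1,2)]] pq by (simp add: \<psi> H)
      show "\<psi> (x * y) = \<psi> x * \<psi> y" using \<psi>[OF S(6)[OF pq(1,2)]] pq by (simp add: \<psi> H)
    qed
    moreover have "\<psi> x = \<phi> x" if "x \<in> A" for x
      using \<psi>[OF const_polys_in[OF subring that]] by (simp add: map_poly_pCons hom_on_0[OF subring h])
    moreover have "\<psi> x = 0" if "x \<in> P" for x
    proof -
      have "x \<in> adjoin A c" using that idl by (auto simp: ideal_in_def)
      then obtain p where p: "p \<in> polys_in A" "x = poly p c" by (auto simp: adjoin_def)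
      then show ?thesis using ker[of p] that \<psi>[OF p(1)] by (simp add: rel_def)
    qed
    ultimately show "\<exists>\<psi>. hom_on (adjoin A c) \<psi> \<and> (\<forall>x\<in>A. \<psi> x = \<phi> x) \<and> (\<forall>x\<in>P. \<psi> x = 0) \<and> \<psi> u \<noteq> 0"
      using nu U(2) \<psi>[OF U(1)] by (intro exI[of _ \<psi>]) auto
  qed
qed

end

section \<open>Finitely many generators and points over the base field\<close>

fun adjoin_list :: "'a::comm_ring_1 set \<Rightarrow> 'a list \<Rightarrow> 'a set" where
  "adjoin_list A [] = A"
| "adjoin_list A (c # cs) = adjoin_list (adjoin A c) cs"

lemma subring_adjoin_list: "subring_set A \<Longrightarrow> subring_set (adjoin_list A cs)"
  by (induction cs arbitrary: A) (auto intro: subring_adjoin)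

lemma adjoin_list_superset: "subring_set A \<Longrightarrow> A \<subseteq> adjoin_list A cs"
proof (induction cs arbitrary: A)
  case (Cons c cs)
  then show ?case using adjoin_superset[OF Cons.prems] Cons.IH[OF subring_adjoin[OF Cons.prems]] by fastforce
qed simp

lemma adjoin_list_gens: "subring_set A \<Longrightarrow> set cs \<subseteq> adjoin_list A cs"
proof (induction cs arbitrary: A)
  case (Cons c cs)
  then show ?case
    using adjoin_gen[OF Cons.prems] Cons.IH[OF subring_adjoin[OF Cons.prems]]
      adjoin_list_superset[OF subring_adjoin[OF Cons.prems]] by fastforce
qed simp

lemma adjoin_subset:
  assumes "subring_set B" "A \<subseteq> B" "c \<in> B"
  shows "adjoin A c \<subseteq> B"
  unfolding adjoin_def poly_altdef using assms
  by (auto simp: polys_in_def intro!: subring_set_sum subring_setD(6,7)[OF assms(1)])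

lemma adjoin_list_subset:
  "subring_set B \<Longrightarrow> A \<subseteq> B \<Longrightarrow> set cs \<subseteq> B \<Longrightarrow> adjoin_list A cs \<subseteq> B"
  by (induction cs arbitrary: A) (auto simp: adjoin_subset)

lemma prime_ideal_in_Int:
  assumes "prime_ideal_in B P" "subring_set A" "A \<subseteq> B"
  shows "prime_ideal_in A (P \<inter> A)"
  unfolding prime_ideal_in_def ideal_in_def
proof (intro conjI ballI impI)
  note P = assms(1)[unfolded prime_ideal_in_def ideal_in_def]
  note S = subring_setD[OF assms(2)]
  show "P \<inter> A \<noteq> A" using prime_ideal_in_one_notin[OF assms(1)] S(1) by blast
  show "P \<inter> A \<subseteq> A" "0 \<in> P \<inter> A" using P S by auto
  show "x + y \<in> P \<inter> A" if "x \<in> P \<inter> A" "y \<in> P \<inter> A" for x y using that P S by auto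
  show "a * x \<in> P \<inter> A" if "a \<in> A" "x \<in> P \<inter> A" for a x using that P S assms(3) by auto
  show "a \<in> P \<inter> A \<or> b \<in> P \<inter> A" if "a \<in> A" "b \<in> A" "a * b \<in> P \<inter> A" for a b
    using that P assms(3) by blast
qed

text \<open>The demand that \<open>u\<close> survive is passed down one generator at a time: the
  induction hypothesis over A[c] turns it into a demand on some \<open>b\<close> in A[c] outside
  \<open>P\<close>, and the one-generator step turns that into a demand on \<open>a\<close> in
  \<open>A\<close>. Existence of \<open>a\<close> before \<open>\<phi>\<close> is what makes the two
  steps compose.\<close>

lemma hom_extension_list:
  fixes K :: "'k::field itself"
  assumes K: "alg_closed_field K"
  shows "subring_set A \<Longrightarrow> prime_ideal_in (adjoin_list A cs) P \<Longrightarrow> u \<in> adjoin_list A cs - P \<Longrightarrow>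
   \<exists>a\<in>A - P. \<forall>\<phi> :: 'a::comm_ring_1 \<Rightarrow> 'k. hom_on A \<phi> \<longrightarrow> (\<forall>x\<in>P \<inter> A. \<phi> x = 0) \<longrightarrow> \<phi> a \<noteq> 0 \<longrightarrow>
    (\<exists>\<psi>. hom_on (adjoin_list A cs) \<psi> \<and> (\<forall>x\<in>A. \<psi> x = \<phi> x) \<and> (\<forall>x\<in>P. \<psi> x = 0) \<and> \<psi> u \<noteq> 0)"
proof (induction cs arbitrary: A)
  case Nil
  then have "P \<subseteq> A" by (auto simp: prime_ideal_in_def ideal_in_def)
  then show ?case using Nil by (intro bexI[of _ u]) auto
next
  case (Cons c cs)
  note sub = subring_adjoin[OF Cons.prems(1), of c]
  from Cons.IH[OF sub] Cons.prems obtain b where b: "b \<in> adjoin A c - P" and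
    ext: "\<And>\<phi> :: 'a \<Rightarrow> 'k. hom_on (adjoin A c) \<phi> \<Longrightarrow> (\<forall>x\<in>P \<inter> adjoin A c. \<phi> x = 0) \<Longrightarrow> \<phi> b \<noteq> 0 \<Longrightarrow>
    (\<exists>\<psi>. hom_on (adjoin_list A (c # cs)) \<psi> \<and> (\<forall>x\<in>adjoin A c. \<psi> x = \<phi> x) \<and> (\<forall>x\<in>P. \<psi> x = 0) \<and> \<psi> u \<noteq> 0)"
    by (auto 0 3)
  interpret prime_of_adjoin A c "P \<inter> adjoin A c"
    using prime_ideal_in_Int[OF Cons.prems(2) sub] adjoin_list_superset[OF sub, of cs] Cons.prems(1)
    by unfold_locales auto
  have "b \<in> adjoin A c - P \<inter> adjoin A c" using b by auto
  from hom_extension[OF K this] obtain a where a: "a \<in> A - P \<inter> adjoin A c" and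
    ext': "\<And>\<phi> :: 'a \<Rightarrow> 'k. hom_on A \<phi> \<Longrightarrow> (\<forall>x\<in>P \<inter> adjoin A c \<inter> A. \<phi> x = 0) \<Longrightarrow> \<phi> a \<noteq> 0 \<Longrightarrow>
    (\<exists>\<psi>. hom_on (adjoin A c) \<psi> \<and> (\<forall>x\<in>A. \<psi> x = \<phi> x) \<and> (\<forall>x\<in>P \<inter> adjoin A c. \<psi> x = 0) \<and> \<psi> b \<noteq> 0)"
    by blast
  show ?case
  proof (intro bexI[of _ a] allI impI)
    show "a \<in> A - P" using a A_sub by auto
    fix \<phi> :: "'a \<Rightarrow> 'k" assume h: "hom_on A \<phi>" and k: "\<forall>x\<in>P \<inter> A. \<phi> x = 0" and nz: "\<phi> a \<noteq> 0"
    obtain \<psi> where \<psi>: "hom_on (adjoin A c) \<psi>" "\<forall>x\<in>A. \<psi> x = \<phi> x" "\<forall>x\<in>P \<inter> adjoin A c. \<psi> x = 0" "\<psi> b \<noteq> 0"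
      using ext'[OF h _ nz] k by auto
    from ext[OF \<psi>(1,3,4)] \<psi>(2) A_sub
    show "\<exists>\<psi>. hom_on (adjoin_list A (c # cs)) \<psi> \<and> (\<forall>x\<in>A. \<psi> x = \<phi> x) \<and> (\<forall>x\<in>P. \<psi> x = 0) \<and> \<psi> u \<noteq> 0"
      by metis
  qed
qed

text \<open>A prime contains no nonzero scalar, since that would be a unit. Hence
  \<open>\<kappa>\<close> is injective, its inverse kills the contraction of \<open>P\<close>
  trivially, and the element \<open>a\<close> demanded by \<open>hom_extension_list\<close> is a
  nonzero scalar, which survives automatically.\<close>

theorem nullstellensatz:
  fixes \<kappa> :: "'k::field \<Rightarrow> 'a::comm_ring_1"
  assumes K: "alg_closed_field TYPE('k)" and \<kappa>: "ring_hom_fun \<kappa>"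
    and P: "prime_ideal_in (adjoin_list (range \<kappa>) cs) P" and u: "u \<in> adjoin_list (range \<kappa>) cs - P"
  shows "\<exists>\<phi> :: 'a \<Rightarrow> 'k. hom_on (adjoin_list (range \<kappa>) cs) \<phi> \<and> (\<forall>k. \<phi> (\<kappa> k) = k) \<and> (\<forall>x\<in>P. \<phi> x = 0) \<and> \<phi> u \<noteq> 0"
proof -
  have k1: "\<kappa> 1 = 1" and ka: "\<And>x y. \<kappa> (x + y) = \<kappa> x + \<kappa> y" and km: "\<And>x y. \<kappa> (x * y) = \<kappa> x * \<kappa> y"
    using \<kappa> by (auto simp: ring_hom_fun_def)
  have k0: "\<kappa> 0 = 0" using ka[of 0 0] by simp
  have kd: "\<kappa> x - \<kappa> y = \<kappa> (x - y)" for x y using ka[of "x - y" y] by simp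
  have sub: "subring_set (range \<kappa>)"
    unfolding subring_set_def by (auto simp: kd km[symmetric]) (metis k1 rangeI)
  have unit: "x = 0" if "\<kappa> x \<in> P" for x
  proof (rule ccontr)
    assume "x \<noteq> 0"
    then have "\<kappa> (inverse x) * \<kappa> x = 1" by (simp add: km[symmetric] k1)
    moreover have "\<kappa> (inverse x) \<in> adjoin_list (range \<kappa>) cs" using adjoin_list_superset[OF sub] by blast
    ultimately have "1 \<in> P" using that P ideal_in_mult unfolding prime_ideal_in_def by metis
    then show False using prime_ideal_in_one_notin[OF P] by blast
  qed
  have "0 \<in> P" using P by (simp add: prime_ideal_in_def ideal_in_def)
  have inj: "inj \<kappa>"
  proof (rule injI)
    fix x y assume "\<kappa> x = \<kappa> y"
    then have "\<kappa> (x - y) \<in> P" using kd[of x y] \<open>0 \<in> P\<close> by simp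
    then show "x = y" using unit[of "x - y"] by simp
  qed
  obtain a where a: "a \<in> range \<kappa> - P" and ext: "\<And>\<phi> :: 'a \<Rightarrow> 'k. hom_on (range \<kappa>) \<phi> \<Longrightarrow> (\<forall>x\<in>P \<inter> range \<kappa>. \<phi> x = 0) \<Longrightarrow> \<phi> a \<noteq> 0 \<Longrightarrow>
    (\<exists>\<psi>. hom_on (adjoin_list (range \<kappa>) cs) \<psi> \<and> (\<forall>x\<in>range \<kappa>. \<psi> x = \<phi> x) \<and> (\<forall>x\<in>P. \<psi> x = 0) \<and> \<psi> u \<noteq> 0)"
    using hom_extension_list[OF K sub P u] by blast
  have "hom_on (range \<kappa>) (inv \<kappa>)"
    unfolding hom_on_def
    by (auto simp: ka[symmetric] km[symmetric] inv_f_f[OF inj]) (metis inv_f_f[OF inj] k1)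
  moreover have "\<forall>x\<in>P \<inter> range \<kappa>. inv \<kappa> x = 0" using unit by (auto simp: inv_f_f[OF inj])
  moreover have "inv \<kappa> a \<noteq> 0" using a k0 \<open>0 \<in> P\<close> by (auto simp: inv_f_f[OF inj])
  ultimately show ?thesis using ext by (metis inv_f_f[OF inj] rangeI)
qed

section \<open>Graded algebras and leading forms\<close>

text \<open>\<open>ideal_gen_in\<close> attaches coefficients to generators as elements, not to
  indices, and \<open>f\<close> may repeat values. One index per value is chosen in one direction,
  and the coefficients of equal values are added in the other.\<close>

lemma ideal_gen_in_UNIV_lessThan:
  fixes f :: "nat \<Rightarrow> 'b::comm_ring_1"
  shows "x \<in> ideal_gen_in UNIV (f ` {..<n}) \<longleftrightarrow> (\<exists>t. x = (\<Sum>i<n. f i * t i))"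
proof
  assume "x \<in> ideal_gen_in UNIV (f ` {..<n})"
  then obtain Y r where Y: "finite Y" "Y \<subseteq> f ` {..<n}" "x = (\<Sum>y\<in>Y. r y * y)"
    by (auto simp: ideal_gen_in_def)
  then obtain C where C: "C \<subseteq> {..<n}" "inj_on f C" "Y = f ` C"
    using subset_image_inj[of Y f "{..<n}"] by blast
  have "(\<Sum>i<n. f i * (if i \<in> C then r (f i) else 0)) = (\<Sum>i\<in>C. r (f i) * f i)"
    using C(1) by (intro sum.mono_neutral_cong_right) (auto simp: mult.commute)
  also have "\<dots> = x" unfolding Y(3) C(3) by (subst sum.reindex[OF C(2)]) simp
  finally show "\<exists>t. x = (\<Sum>i<n. f i * t i)" by (intro exI[of _ "\<lambda>i. if i \<in> C then r (f i) else 0"]) simp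
next
  assume "\<exists>t. x = (\<Sum>i<n. f i * t i)"
  then obtain t where t: "x = (\<Sum>i<n. f i * t i)" ..
  have "(\<Sum>i<n. f i * t i) = (\<Sum>y\<in>f ` {..<n}. \<Sum>i\<in>{i. i \<in> {..<n} \<and> f i = y}. f i * t i)"
    by (rule sum.image_gen) simp
  also have "\<dots> = (\<Sum>y\<in>f ` {..<n}. (\<Sum>i\<in>{i. i \<in> {..<n} \<and> f i = y}. t i) * y)"
    by (intro sum.cong) (auto simp: sum_distrib_left mult.commute)
  finally show "x \<in> ideal_gen_in UNIV (f ` {..<n})"
    unfolding ideal_gen_in_def t
    by (intro CollectI exI[of _ "f ` {..<n}"] exI[of _ "\<lambda>y. \<Sum>i\<in>{i. i \<in> {..<n} \<and> f i = y}. t i"]) auto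
qed

locale graded =
  fixes \<iota> :: "'k::field \<Rightarrow> 'b::comm_ring_1" and G :: "nat \<Rightarrow> 'b set"
  assumes graded: "graded_algebra \<iota> G"
begin

lemma \<iota>_hom: "\<iota> 1 = 1" "\<iota> (x + y) = \<iota> x + \<iota> y" "\<iota> (x * y) = \<iota> x * \<iota> y"
  using graded by (auto simp: graded_algebra_def ring_hom_fun_def)

lemma \<iota>_0: "\<iota> 0 = 0" using \<iota>_hom(2)[of 0 0] by simp

lemma \<iota>_uminus: "\<iota> (- x) = - \<iota> x"
proof -
  have "\<iota> x + \<iota> (- x) = 0" using \<iota>_hom(2)[of x "- x"] \<iota>_0 by simp
  then show ?thesis by (rule add.inverse_unique[symmetric])
qed

lemma G_intros:
  "0 \<in> G d" "x \<in> G d \<Longrightarrow> y \<in> G d \<Longrightarrow> x + y \<in> G d" "x \<in> G d \<Longrightarrow> \<iota> a * x \<in> G d"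
  "x \<in> G i \<Longrightarrow> y \<in> G j \<Longrightarrow> x * y \<in> G (i + j)" "\<iota> a \<in> G 0"
  using graded by (auto simp: graded_algebra_def)

lemma G_sum: "(\<And>i. i \<in> I \<Longrightarrow> f i \<in> G d) \<Longrightarrow> sum f I \<in> G d"
  by (induction I rule: infinite_finite_induct) (auto intro: G_intros)

definition comps :: "'b \<Rightarrow> nat \<Rightarrow> 'b" where
  "comps s = (THE h. finite {d. h d \<noteq> 0} \<and> (\<forall>d. h d \<in> G d) \<and> s = (\<Sum>d\<in>{d. h d \<noteq> 0}. h d))"

lemma comps: "finite {d. comps s d \<noteq> 0}" "comps s d \<in> G d" "s = (\<Sum>d\<in>{d. comps s d \<noteq> 0}. comps s d)"
  and comps_unique: "finite {d. h d \<noteq> 0} \<Longrightarrow> (\<And>d. h d \<in> G d) \<Longrightarrow> s = (\<Sum>d\<in>{d. h d \<noteq> 0}. h d) \<Longrightarrow> comps s = h"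
proof -
  have ex: "\<exists>!h. finite {d. h d \<noteq> 0} \<and> (\<forall>d. h d \<in> G d) \<and> s = (\<Sum>d\<in>{d. h d \<noteq> 0}. h d)"
    using graded unfolding graded_algebra_def by simp
  from theI'[OF ex] show "finite {d. comps s d \<noteq> 0}" "comps s d \<in> G d" "s = (\<Sum>d\<in>{d. comps s d \<noteq> 0}. comps s d)"
    unfolding comps_def[symmetric] by blast+
  show "comps s = h" if "finite {d. h d \<noteq> 0}" "\<And>d. h d \<in> G d" "s = (\<Sum>d\<in>{d. h d \<noteq> 0}. h d)"
    unfolding comps_def by (intro the1_equality[OF ex] conjI allI that)
qed

lemma comps_eqI:
  assumes "\<And>d. h d \<in> G d" "\<And>d. d \<ge> N \<Longrightarrow> h d = 0" "s = (\<Sum>d<N. h d)"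
  shows "comps s = h"
proof (rule comps_unique)
  have *: "{d. h d \<noteq> 0} \<subseteq> {..<N}" using assms(2) not_le by blast
  then show "finite {d. h d \<noteq> 0}" by (rule finite_subset) simp
  show "s = (\<Sum>d\<in>{d. h d \<noteq> 0}. h d)"
    unfolding assms(3) by (rule sum.mono_neutral_right) (use * in auto)
qed fact

lemma comps_bound: "\<exists>N. \<forall>d\<ge>N. comps s d = 0"
proof -
  obtain N where "\<forall>d\<in>{d. comps s d \<noteq> 0}. d < N" using comps(1)[of s] finite_nat_set_iff_bounded by blast
  then show ?thesis by (intro exI[of _ N]) auto
qed

lemma sum_comps:
  assumes "\<And>d. d \<ge> N \<Longrightarrow> comps s d = 0"
  shows "s = (\<Sum>d<N. comps s d)"
proof -
  have *: "{d. comps s d \<noteq> 0} \<subseteq> {..<N}" using assms not_le by blast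
  show ?thesis by (rule trans[OF comps(3)], intro sum.mono_neutral_left) (use * in auto)
qed

lemma comps_add: "comps (s + t) d = comps s d + comps t d"
proof -
  obtain N M where "\<forall>d\<ge>N. comps s d = 0" "\<forall>d\<ge>M. comps t d = 0" using comps_bound by metis
  then have b: "\<And>d. d \<ge> max N M \<Longrightarrow> comps s d = 0" "\<And>d. d \<ge> max N M \<Longrightarrow> comps t d = 0" by auto
  have "comps (s + t) = (\<lambda>d. comps s d + comps t d)"
  proof (rule comps_eqI[of _ "max N M"])
    show "s + t = (\<Sum>d<max N M. comps s d + comps t d)"
      using arg_cong2[OF sum_comps[of "max N M" s, OF b(1)] sum_comps[of "max N M" t, OF b(2)], of "(+)"]
      by (simp only: sum.distrib)
  qed (auto simp: b intro: G_intros comps(2))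
  then show ?thesis by simp
qed

lemma comps_0: "comps 0 d = 0"
  using comps_add[of 0 0 d] by simp

lemma comps_uminus: "comps (- s) d = - comps s d"
proof -
  have "comps s d + comps (- s) d = 0" using comps_add[of s "- s" d] comps_0 by simp
  then show ?thesis by (rule add.inverse_unique[symmetric])
qed

lemma comps_diff: "comps (s - t) d = comps s d - comps t d"
  using comps_add[of s "- t" d] by (simp add: comps_uminus)

lemma comps_sum: "comps (sum f I) d = (\<Sum>i\<in>I. comps (f i) d)"
  by (induction I rule: infinite_finite_induct) (auto simp: comps_0 comps_add)

lemma comps_homogeneous: "x \<in> G e \<Longrightarrow> comps x d = (if d = e then x else 0)"
  using comps_eqI[of "\<lambda>d. if d = e then x else 0" "Suc e" x] by (simp add: G_intros(1))

lemma comps_mult_homogeneous: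
  assumes "x \<in> G e"
  shows "comps (x * s) d = (if e \<le> d then x * comps s (d - e) else 0)"
proof -
  obtain N where N: "\<And>d. d \<ge> N \<Longrightarrow> comps s d = 0" using comps_bound by metis
  have "x * s = x * (\<Sum>i<N. comps s i)" by (rule arg_cong[OF sum_comps[OF N]])
  also have "\<dots> = (\<Sum>i<N. x * comps s i)" by (rule sum_distrib_left)
  finally have "comps (x * s) d = comps (\<Sum>i<N. x * comps s i) d" by (rule arg_cong)
  also have "\<dots> = (\<Sum>i<N. comps (x * comps s i) d)" by (rule comps_sum)
  also have "\<dots> = (\<Sum>i<N. if d = e + i then x * comps s i else 0)"
    by (intro sum.cong refl comps_homogeneous G_intros assms comps(2))
  also have "\<dots> = (\<Sum>i<N. if i = d - e then if e \<le> d then x * comps s i else 0 else 0)"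
    by (intro sum.cong) auto
  also have "\<dots> = (if e \<le> d then x * comps s (d - e) else 0)"
    using N[of "d - e"] by (auto simp: not_less)
  finally show ?thesis .
qed

lemma comps_scale: "comps (\<iota> a * s) d = \<iota> a * comps s d"
  using comps_mult_homogeneous[OF G_intros(5), of a s d] by simp

text \<open>The leading forms of the shifted regular sequence \<open>F i - x i\<close> generate no more than the
  ideal of the \<open>F i\<close>: a relation that cancels the top degree has coefficients whose own top
  degree can be lowered by regularity.\<close>

lemma leading_form_shifted:
  fixes F :: "nat \<Rightarrow> 'b" and x :: "nat \<Rightarrow> 'k" and \<delta> :: "nat \<Rightarrow> nat"
  assumes F: "\<And>i. i < n \<Longrightarrow> F i \<in> G (\<delta> i)" and pos: "\<And>i. i < n \<Longrightarrow> \<delta> i > 0"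
    and reg: "\<And>i y. i < n \<Longrightarrow> y * F i \<in> ideal_gen_in UNIV (F ` {..<i}) \<Longrightarrow> y \<in> ideal_gen_in UNIV (F ` {..<i})"
    and h: "h \<in> ideal_gen_in UNIV ((\<lambda>i. F i - \<iota> (x i)) ` {..<n})" "\<And>k. k > d \<Longrightarrow> comps h k = 0"
  shows "comps h d \<in> ideal_gen_in UNIV (F ` {..<n})"
  using assms
proof (induction n arbitrary: h d)
  case 0
  have "x \<in> ideal_gen_in UNIV {} \<longleftrightarrow> x = 0" for x :: 'b by (auto simp: ideal_gen_in_def)
  with 0 show ?case by (simp add: comps_0)
next
  case (Suc n)
  let ?L = "\<lambda>i. F i - \<iota> (x i)"
  note IH = Suc.IH[OF Suc.prems(1,2,3)]
  have reg_n: "y * F n \<in> ideal_gen_in UNIV (F ` {..<n}) \<Longrightarrow> y \<in> ideal_gen_in UNIV (F ` {..<n})" for y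
    using Suc.prems(3)[of n y] by simp
  have F': "F i \<in> G (\<delta> i)" "\<delta> i > 0" if "i < n" for i using Suc.prems(1,2) that by auto
  have Fn: "F n \<in> G (\<delta> n)" "\<delta> n > 0" using Suc.prems(1,2) by auto
  have comps_L: "comps (?L n * t) k = (if \<delta> n \<le> k then F n * comps t (k - \<delta> n) else 0) - \<iota> (x n) * comps t k" for t k
    by (simp add: left_diff_distrib comps_diff comps_scale comps_mult_homogeneous[OF Fn(1)])
  \<comment> \<open>An inner induction on a degree bound \<open>E\<close> for the coefficient
    \<open>t\<close> of the last generator; \<open>h'\<close> is the contribution of the first
    \<open>n\<close> generators.\<close>
  have main: "comps (h' + ?L n * t) d \<in> ideal_gen_in UNIV (F ` {..<Suc n})"
    if "h' \<in> ideal_gen_in UNIV (?L ` {..<n})" "\<forall>k\<ge>E. comps t k = 0" "\<forall>k>d. comps (h' + ?L n * t) k = 0" for E h' t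
    using that
  proof (induction E arbitrary: h' t)
    case 0
    then have t: "comps t k = 0" for k by simp
    have c: "comps (h' + ?L n * t) k = comps h' k" for k by (simp add: comps_add comps_L t)
    have "comps h' d \<in> ideal_gen_in UNIV (F ` {..<n})"
      using IH[of h' d] 0 c by auto
    then obtain s where "comps h' d = (\<Sum>i<n. F i * s i)" by (auto simp: ideal_gen_in_UNIV_lessThan)
    then show ?case unfolding c by (auto simp: ideal_gen_in_UNIV_lessThan intro!: exI[of _ "s(n := 0)"])
  next
    case (Suc E)
    have big: "comps (?L n * t) k = 0" if "k > E + \<delta> n" for k
      using that Suc.prems(2) Fn(2) by (simp add: comps_L)
    have top: "comps (?L n * t) (E + \<delta> n) = F n * comps t E"
      using Suc.prems(2) Fn(2) by (simp add: comps_L)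
    show ?case
    proof (cases "E + \<delta> n \<le> d")
      \<comment> \<open>Here \<open>?L n * t\<close> has nothing above degree \<open>d\<close>, so
        neither has \<open>h'\<close>. As \<open>\<delta> n > 0\<close>, the component of
        \<open>t\<close> in degree \<open>d\<close> is 0, and the scalar part of \<open>?L n\<close>
        does not reach degree \<open>d\<close>.\<close>
      case True
      have "comps h' k = 0" if "k > d" for k
        using Suc.prems(3)[rule_format, of k] big[of k] that True by (simp add: comps_add)
      then have "comps h' d \<in> ideal_gen_in UNIV (F ` {..<n})" using IH Suc.prems(1) by auto
      then obtain s where s: "comps h' d = (\<Sum>i<n. F i * s i)" by (auto simp: ideal_gen_in_UNIV_lessThan)
      have "comps (?L n * t) d = F n * comps t (d - \<delta> n)"
        using Suc.prems(2) Fn(2) True by (simp add: comps_L)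
      then show ?thesis using s
        by (auto simp: ideal_gen_in_UNIV_lessThan comps_add intro!: exI[of _ "s(n := comps t (d - \<delta> n))"])
    next
      \<comment> \<open>Degree \<open>E + \<delta> n\<close> lies above \<open>d\<close>, so the top
        forms cancel there. That puts \<open>F n * comps t E\<close> into the ideal of the earlier
        forms, and regularity puts \<open>comps t E\<close> into it as well.\<close>
      case False
      have "comps h' k = 0" if "k > E + \<delta> n" for k
        using Suc.prems(3)[rule_format, of k] big[of k] that False by (simp add: comps_add)
      then have "comps h' (E + \<delta> n) \<in> ideal_gen_in UNIV (F ` {..<n})" using IH Suc.prems(1) by auto
      moreover have "F n * comps t E = - comps h' (E + \<delta> n)"
        using Suc.prems(3)[rule_format, of "E + \<delta> n"] top False
        by (simp add: comps_add eq_neg_iff_add_eq_0 add.commute)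
      ultimately obtain s where "F n * comps t E = - (\<Sum>i<n. F i * s i)"
        by (auto simp: ideal_gen_in_UNIV_lessThan)
      then have "comps t E * F n = (\<Sum>i<n. F i * - s i)" by (simp add: sum_negf mult.commute)
      then have "comps t E * F n \<in> ideal_gen_in UNIV (F ` {..<n})"
        by (subst ideal_gen_in_UNIV_lessThan) (rule exI)
      then have "comps t E \<in> ideal_gen_in UNIV (F ` {..<n})" using reg_n by blast
      then obtain a where a: "comps t E = (\<Sum>i<n. F i * a i)" by (auto simp: ideal_gen_in_UNIV_lessThan)
      \<comment> \<open>Only the part of \<open>a i\<close> of degree \<open>E - \<delta> i\<close>
        contributes to degree \<open>E\<close>. For \<open>\<delta> i > E\<close> there is none, and
        the guard keeps truncated subtraction from supplying one.\<close>
      define b where "b i = (if \<delta> i \<le> E then comps (a i) (E - \<delta> i) else 0)" for i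
      have bE: "comps t E = (\<Sum>i<n. F i * b i)"
      proof -
        have "comps t E = comps (comps t E) E" by (simp add: comps_homogeneous[OF comps(2)])
        also have "\<dots> = (\<Sum>i<n. comps (F i * a i) E)" by (simp add: a comps_sum)
        also have "\<dots> = (\<Sum>i<n. F i * b i)"
          by (intro sum.cong) (auto simp: comps_mult_homogeneous[OF F'(1)] b_def)
        finally show ?thesis .
      qed
      \<comment> \<open>Replacing \<open>F i\<close> by \<open>?L i\<close> alters the sum only
        below degree \<open>E\<close>, because \<open>\<delta> i > 0\<close>. Subtracting
        \<open>?s\<close> from \<open>t\<close> therefore removes its component of degree
        \<open>E\<close>, and the compensating \<open>?L n * ?s\<close> is a combination of the
        first \<open>n\<close> generators, so it can move into \<open>h'\<close>.\<close>
      let ?s = "\<Sum>i<n. ?L i * b i"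
      have "comps ?s k = (if k = E then comps t E else 0)" if "k \<ge> E" for k
      proof -
        have "comps (?L i * b i) k = (if k = E then F i * b i else 0)" if "i < n" for i
        proof (cases "\<delta> i \<le> E")
          case True
          then have "b i \<in> G (E - \<delta> i)" by (simp add: b_def comps(2))
          from comps_homogeneous[OF this] show ?thesis
            using \<open>k \<ge> E\<close> F'[OF that] True
            by (auto simp: left_diff_distrib comps_diff comps_scale comps_mult_homogeneous)
        qed (simp add: b_def comps_0)
        then show ?thesis by (simp add: comps_sum bE)
      qed
      then have t': "\<forall>k\<ge>E. comps (t - ?s) k = 0" using Suc.prems(2) by (auto simp: comps_diff)
      have eq: "h' + ?L n * t = (h' + ?L n * ?s) + ?L n * (t - ?s)" by (simp add: algebra_simps)
      obtain s where s: "h' = (\<Sum>i<n. ?L i * s i)" using Suc.prems(1) by (auto simp: ideal_gen_in_UNIV_lessThan)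
      have "h' + ?L n * ?s = (\<Sum>i<n. ?L i * (s i + ?L n * b i))"
        by (simp add: s sum_distrib_left sum.distrib[symmetric] algebra_simps)
      then have "h' + ?L n * ?s \<in> ideal_gen_in UNIV (?L ` {..<n})" 
        by (subst ideal_gen_in_UNIV_lessThan) (rule exI)
      then show ?thesis unfolding eq by (rule Suc.IH) (use t' Suc.prems(3) eq in auto)
    qed
  qed
  obtain s where s: "h = (\<Sum>i<Suc n. ?L i * s i)" using Suc.prems(4) by (auto simp: ideal_gen_in_UNIV_lessThan)
  obtain E where "\<forall>k\<ge>E. comps (s n) k = 0" using comps_bound by blast
  with main[of "\<Sum>i<n. ?L i * s i" E "s n"] Suc.prems(5) s show ?case
    by (auto simp: ideal_gen_in_UNIV_lessThan[of _ ?L])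
qed

end

section \<open>Homomorphisms of polynomial rings\<close>

lemma ring_hom_funD:
  assumes "ring_hom_fun f"
  shows "f 1 = 1" "f (x + y) = f x + f y" "f (x * y) = f x * f y" "f 0 = 0" "f (- x) = - f x" "f (x - y) = f x - f y"
proof -
  show "f 1 = 1" and a: "\<And>x y. f (x + y) = f x + f y" and "f (x * y) = f x * f y"
    using assms by (auto simp: ring_hom_fun_def)
  show 0: "f 0 = 0" using a[of 0 0] by simp
  show m: "\<And>x. f (- x) = - f x" using a 0 by (metis add.inverse_unique add.right_inverse)
  show "f (x - y) = f x - f y" using a[of x "- y"] m[of y] by simp
qed

lemma ring_hom_fun_sum: "ring_hom_fun f \<Longrightarrow> f (sum g I) = (\<Sum>i\<in>I. f (g i))"
  by (induction I rule: infinite_finite_induct) (auto simp: ring_hom_funD)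

lemma sum_single_lookup: "(\<Sum>k\<in>Poly_Mapping.keys p. Poly_Mapping.single k (Poly_Mapping.lookup p k)) = p"
  by (rule poly_mapping_eqI)
     (auto simp: lookup_sum lookup_single when_def in_keys_iff sum.delta'[OF finite_keys])

lemma poly_mapping_induct_single:
  fixes p :: "'i \<Rightarrow>\<^sub>0 'a::comm_monoid_add"
  assumes "P 0" "\<And>k. k \<in> Poly_Mapping.keys p \<Longrightarrow> P (Poly_Mapping.single k (Poly_Mapping.lookup p k))"
    "\<And>p q. P p \<Longrightarrow> P q \<Longrightarrow> P (p + q)"
  shows "P p"
proof -
  have "P (\<Sum>k\<in>I. Poly_Mapping.single k (Poly_Mapping.lookup p k))" if "I \<subseteq> Poly_Mapping.keys p" for I
    using that by (induction I rule: infinite_finite_induct) (auto intro: assms)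
  from this[OF subset_refl] show ?thesis by (simp add: sum_single_lookup)
qed

text \<open>Products are biadditive, so multiplicativity is inherited from monomials, first in the
  right factor and then in the left.\<close>

lemma additive_hom_multI:
  fixes f :: "('i::comm_monoid_add \<Rightarrow>\<^sub>0 'a::comm_ring_1) \<Rightarrow> 'b::comm_ring_1"
  assumes add: "\<And>p q. f (p + q) = f p + f q"
    and single: "\<And>j k a b. f (Poly_Mapping.single (j + k) (a * b)) = f (Poly_Mapping.single j a) * f (Poly_Mapping.single k b)"
  shows "f (p * q) = f p * f q"
proof -
  have f0: "f 0 = 0" using add[of 0 0] by simp
  have s: "f (Poly_Mapping.single k a * q) = f (Poly_Mapping.single k a) * f q" for k a
    by (rule poly_mapping_induct_single[of _ q]) (auto simp: f0 distrib_left add mult_single single)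
  show ?thesis
    by (rule poly_mapping_induct_single[of _ p]) (auto simp: f0 distrib_right add s)
qed

definition monom_val :: "(nat \<Rightarrow> 'b::comm_ring_1) \<Rightarrow> (nat \<Rightarrow>\<^sub>0 nat) \<Rightarrow> 'b" where
  "monom_val x mon = (\<Prod>i\<in>Poly_Mapping.keys mon. x i ^ Poly_Mapping.lookup mon i)"

definition eval_hom :: "('a::comm_ring_1 \<Rightarrow> 'b::comm_ring_1) \<Rightarrow> (nat \<Rightarrow> 'b) \<Rightarrow> ((nat \<Rightarrow>\<^sub>0 nat) \<Rightarrow>\<^sub>0 'a) \<Rightarrow> 'b" where
  "eval_hom h x p = (\<Sum>mon\<in>Poly_Mapping.keys p. h (Poly_Mapping.lookup p mon) * monom_val x mon)"

definition Const :: "'a::comm_ring_1 \<Rightarrow> ((nat \<Rightarrow>\<^sub>0 nat) \<Rightarrow>\<^sub>0 'a)" where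
  "Const = Poly_Mapping.single 0"

definition Var :: "nat \<Rightarrow> ((nat \<Rightarrow>\<^sub>0 nat) \<Rightarrow>\<^sub>0 'a::comm_ring_1)" where
  "Var i = Poly_Mapping.single (Poly_Mapping.single i 1) 1"

lemma mpoly_eval_eq: "mpoly_eval = eval_hom"
  by (intro ext) (simp add: mpoly_eval_def eval_hom_def monom_val_def)

lemma monom_val_superset:
  assumes "finite I" "Poly_Mapping.keys mon \<subseteq> I"
  shows "monom_val x mon = (\<Prod>i\<in>I. x i ^ Poly_Mapping.lookup mon i)"
  unfolding monom_val_def by (rule prod.mono_neutral_left) (use assms in \<open>auto simp: in_keys_iff\<close>)

lemma monom_val_add: "monom_val x (j + k) = monom_val x j * monom_val x k"
  using monom_val_superset[of "Poly_Mapping.keys j \<union> Poly_Mapping.keys k" _ x] keys_add[of j k]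
  by (simp add: lookup_add power_add prod.distrib)

lemma monom_val_0: "monom_val x 0 = 1"
  by (simp add: monom_val_def)

lemma eval_hom_superset:
  assumes "finite I" "Poly_Mapping.keys p \<subseteq> I" "h 0 = 0"
  shows "eval_hom h x p = (\<Sum>mon\<in>I. h (Poly_Mapping.lookup p mon) * monom_val x mon)"
  unfolding eval_hom_def by (rule sum.mono_neutral_left) (use assms in \<open>auto simp: in_keys_iff\<close>)

lemma eval_hom_single: "h 0 = 0 \<Longrightarrow> eval_hom h x (Poly_Mapping.single mon a) = h a * monom_val x mon"
  by (simp add: eval_hom_def)

lemma ring_hom_eval_hom:
  assumes h: "ring_hom_fun h"
  shows "ring_hom_fun (eval_hom h x)"
proof -
  note h = ring_hom_funD[OF h]
  have add: "eval_hom h x (p + q) = eval_hom h x p + eval_hom h x q" for p q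
    using eval_hom_superset[of "Poly_Mapping.keys p \<union> Poly_Mapping.keys q" _ h x] keys_add[of p q]
    by (simp add: h lookup_add distrib_right sum.distrib)
  show ?thesis
    unfolding ring_hom_fun_def
    by (auto intro!: additive_hom_multI
        simp: add eval_hom_single h monom_val_add single_one[symmetric] monom_val_0 simp del: single_one)
qed

lemma lookup_map_hom: "f 0 = 0 \<Longrightarrow> Poly_Mapping.lookup (Poly_Mapping.map f p) k = f (Poly_Mapping.lookup p k)"
  by transfer (simp add: when_def)

lemma ring_hom_map:
  fixes f :: "'a::comm_ring_1 \<Rightarrow> 'b::comm_ring_1"
  assumes f: "ring_hom_fun f"
  shows "ring_hom_fun (Poly_Mapping.map f :: ('i::comm_monoid_add \<Rightarrow>\<^sub>0 'a) \<Rightarrow> _)"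
proof -
  note f = ring_hom_funD[OF f]
  have add: "Poly_Mapping.map f (p + q) = Poly_Mapping.map f p + Poly_Mapping.map f q" for p q :: "'i \<Rightarrow>\<^sub>0 'a"
    by (rule poly_mapping_eqI) (simp add: lookup_map_hom lookup_add f)
  have s: "Poly_Mapping.map f (Poly_Mapping.single k a) = Poly_Mapping.single k (f a)" for k :: 'i and a
    by (simp add: f)
  show ?thesis
    unfolding ring_hom_fun_def
    by (auto intro!: additive_hom_multI simp: add s f mult_single single_one[symmetric] simp del: single_one map_single)
qed

lemma ring_hom_Const: "ring_hom_fun Const"
  by (auto simp: ring_hom_fun_def Const_def single_add mult_single)

lemma Var_power: "Var i ^ k = Poly_Mapping.single (Poly_Mapping.single i k) 1"
  by (induction k) (auto simp: Var_def mult_single single_add[symmetric] simp del: single_add)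

lemma prod_single_one:
  "(\<Prod>i\<in>I. Poly_Mapping.single (g i) (1::'a::comm_ring_1)) = Poly_Mapping.single (\<Sum>i\<in>I. g i) 1"
  by (induction I rule: infinite_finite_induct) (auto simp: mult_single)

lemma single_eq_Const_monom_val: "Poly_Mapping.single mon a = Const a * monom_val Var mon"
  by (simp add: monom_val_def Var_power prod_single_one sum_single_lookup Const_def mult_single)

lemma subring_set_monom_val:
  assumes "subring_set B" "\<And>i. i \<in> Poly_Mapping.keys mon \<Longrightarrow> x i \<in> B"
  shows "monom_val x mon \<in> B"
proof -
  have "(\<Prod>i\<in>I. x i ^ Poly_Mapping.lookup mon i) \<in> B" if "I \<subseteq> Poly_Mapping.keys mon" for I
    using that by (induction I rule: infinite_finite_induct) (auto intro: subring_setD[OF assms(1)] assms(2))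
  then show ?thesis by (simp add: monom_val_def)
qed

text \<open>A polynomial ring is the least subring containing its constants and variables. Claims
  about all polynomials thus reduce to closure of a suitable set under ring operations.\<close>

lemma polys_over_subset:
  assumes B: "subring_set B" "\<And>a. a \<in> A \<Longrightarrow> Const a \<in> B" "\<And>i. i < m \<Longrightarrow> Var i \<in> B"
  shows "polys_over A m \<subseteq> B"
proof
  fix p assume p: "p \<in> polys_over A m"
  show "p \<in> B"
  proof (rule poly_mapping_induct_single[of "\<lambda>p. p \<in> B"])
    fix k assume k: "k \<in> Poly_Mapping.keys p"
    show "Poly_Mapping.single k (Poly_Mapping.lookup p k) \<in> B"
      unfolding single_eq_Const_monom_val
      using p k by (auto simp: polys_over_def intro!: subring_setD(6)[OF B(1)] subring_set_monom_val[OF B(1)] B)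
  qed (auto intro: subring_setD[OF B(1)])
qed

lemma polys_over_single:
  "0 \<in> A \<Longrightarrow> a \<in> A \<Longrightarrow> Poly_Mapping.keys k \<subseteq> {..<m} \<Longrightarrow> Poly_Mapping.single k a \<in> polys_over A m"
  by (auto simp: polys_over_def lookup_single when_def)

lemma polys_over_add:
  assumes "subring_set A" "p \<in> polys_over A m" "q \<in> polys_over A m"
  shows "p + q \<in> polys_over A m"
  using assms(2,3) keys_add[of p q] subring_setD(4)[OF assms(1)]
  unfolding polys_over_def by (auto simp: lookup_add) (use keys_add in blast)

lemma polys_over_mult:
  assumes A: "subring_set A" and p: "p \<in> polys_over A m" and q: "q \<in> polys_over A m"
  shows "p * q \<in> polys_over A m"
proof (rule poly_mapping_induct_single[of "\<lambda>p. p * q \<in> polys_over A m"])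
  note S = subring_setD[OF A]
  have 0: "0 \<in> polys_over A m" by (simp add: polys_over_def S)
  then show "0 * q \<in> polys_over A m" by simp
  show "\<And>x y. x * q \<in> polys_over A m \<Longrightarrow> y * q \<in> polys_over A m \<Longrightarrow> (x + y) * q \<in> polys_over A m"
    by (simp add: distrib_right polys_over_add[OF A])
  fix k assume k: "k \<in> Poly_Mapping.keys p"
  show "Poly_Mapping.single k (Poly_Mapping.lookup p k) * q \<in> polys_over A m"
  proof (rule poly_mapping_induct_single[of "\<lambda>q. Poly_Mapping.single k (Poly_Mapping.lookup p k) * q \<in> polys_over A m"])
    fix l assume l: "l \<in> Poly_Mapping.keys q"
    have "Poly_Mapping.keys (k + l) \<subseteq> {..<m}"
      using k l p q keys_add[of k l] unfolding polys_over_def by blast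
    then show "Poly_Mapping.single k (Poly_Mapping.lookup p k) * Poly_Mapping.single l (Poly_Mapping.lookup q l) \<in> polys_over A m"
      unfolding mult_single
      by (rule polys_over_single[rotated 2]) (use p q in \<open>auto simp: polys_over_def intro!: S\<close>)
  qed (auto simp: 0 distrib_left polys_over_add[OF A])
qed

lemma subring_polys_over:
  assumes A: "subring_set A"
  shows "subring_set (polys_over A m)"
proof -
  have "x - y \<in> polys_over A m" if "x \<in> polys_over A m" "y \<in> polys_over A m" for x y
  proof -
    have "- 1 \<in> polys_over A m"
      using polys_over_single[of A "- 1" 0 m] subring_setD[OF A] by (simp add: single_uminus)
    then show ?thesis using polys_over_add[OF A that(1), of "- 1 * y"] polys_over_mult[OF A _ that(2), of "- 1"] by simp
  qed
  moreover have "1 \<in> polys_over A m"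
    using polys_over_single[of A 1 0 m] subring_setD[OF A] by simp
  ultimately show ?thesis unfolding subring_set_def using polys_over_mult[OF A] by blast
qed

lemma Const_in_polys_over: "subring_set A \<Longrightarrow> a \<in> A \<Longrightarrow> Const a \<in> polys_over A m"
  by (simp add: Const_def polys_over_single subring_setD)

lemma Var_in_polys_over: "subring_set A \<Longrightarrow> i < m \<Longrightarrow> Var i \<in> polys_over A m"
  by (simp add: Var_def polys_over_single subring_setD)

lemma subring_UNIV: "subring_set UNIV"
  by (simp add: subring_set_def)

text \<open>For the iterated ring K[X][Y]: the coefficients that land in \<open>B\<close> form a
  subring, to which minimality of K[X] applies.\<close>

lemma polys_over_UNIV_subset_nested:
  assumes "subring_set B" "\<And>a. Const (Const a) \<in> B" "\<And>i. i < n \<Longrightarrow> Const (Var i) \<in> B" "\<And>j. j < m \<Longrightarrow> Var j \<in> B"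
  shows "polys_over (polys_over UNIV n) m \<subseteq> B"
proof (rule polys_over_subset[OF assms(1) _ assms(4)])
  note c = ring_hom_funD[OF ring_hom_Const]
  have "subring_set {a. Const a \<in> B}"
    unfolding subring_set_def using subring_setD[OF assms(1)] by (auto simp: c)
  then have "polys_over UNIV n \<subseteq> {a. Const a \<in> B}"
    by (rule polys_over_subset) (use assms in auto)
  then show "\<And>a. a \<in> polys_over UNIV n \<Longrightarrow> Const a \<in> B" by blast
qed

section \<open>Extension of primes\<close>

lemma ideal_gen_in_least:
  assumes "ideal_in A J" "X \<subseteq> J"
  shows "ideal_gen_in A X \<subseteq> J"
proof
  fix x assume "x \<in> ideal_gen_in A X"
  then obtain Y r where Y: "Y \<subseteq> X" "\<forall>y\<in>Y. r y \<in> A" "x = (\<Sum>y\<in>Y. r y * y)"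
    by (auto simp: ideal_gen_in_def)
  show "x \<in> J" unfolding Y(3)
    by (rule ideal_in_sum[OF assms(1)], rule ideal_in_mult[OF assms(1)]) (use Y assms(2) in auto)
qed

lemma ideal_in_ideal_gen:
  assumes A: "subring_set A" and X: "X \<subseteq> A"
  shows "ideal_in A (ideal_gen_in A X)"
  unfolding ideal_in_def
proof (intro conjI ballI)
  note S = subring_setD[OF A]
  show "ideal_gen_in A X \<subseteq> A"
    by (rule ideal_gen_in_least) (use X in \<open>auto simp: ideal_in_def S\<close>)
  show "0 \<in> ideal_gen_in A X" unfolding ideal_gen_in_def by (intro CollectI exI[of _ "{}"]) auto
  fix x assume "x \<in> ideal_gen_in A X"
  then obtain Y r where Y: "finite Y" "Y \<subseteq> X" "\<forall>y\<in>Y. r y \<in> A" "x = (\<Sum>y\<in>Y. r y * y)"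
    by (auto simp: ideal_gen_in_def)
  { fix a assume "a \<in> A"
    then show "a * x \<in> ideal_gen_in A X" unfolding ideal_gen_in_def
      using Y by (intro CollectI exI[of _ Y] exI[of _ "\<lambda>y. a * r y"])
        (auto simp: sum_distrib_left mult.assoc S) }
  fix x' assume "x' \<in> ideal_gen_in A X"
  then obtain Y' r' where Y': "finite Y'" "Y' \<subseteq> X" "\<forall>y\<in>Y'. r' y \<in> A" "x' = (\<Sum>y\<in>Y'. r' y * y)"
    by (auto simp: ideal_gen_in_def)
  \<comment> \<open>Extension by 0 gives both combinations the common support
    \<open>Y \<union> Y'\<close>, so that they can be added termwise.\<close>
  define s where "s y = (if y \<in> Y then r y else 0)" for y
  define s' where "s' y = (if y \<in> Y' then r' y else 0)" for y
  have "x = (\<Sum>y\<in>Y \<union> Y'. s y * y)"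
    unfolding Y(4) using Y(1) Y'(1) by (intro sum.mono_neutral_cong_left) (auto simp: s_def)
  moreover have "x' = (\<Sum>y\<in>Y \<union> Y'. s' y * y)"
    unfolding Y'(4) using Y(1) Y'(1) by (intro sum.mono_neutral_cong_left) (auto simp: s'_def)
  ultimately have "x + x' = (\<Sum>y\<in>Y \<union> Y'. (s y + s' y) * y)"
    by (simp add: sum.distrib distrib_right)
  then show "x + x' \<in> ideal_gen_in A X" unfolding ideal_gen_in_def
    using Y Y' by (intro CollectI exI[of _ "Y \<union> Y'"] exI[of _ "\<lambda>y. s y + s' y"]) (auto simp: s_def s'_def S)
qed

lemma ideal_gen_in_superset:
  assumes "subring_set A"
  shows "X \<subseteq> ideal_gen_in A X"
proof
  fix x assume "x \<in> X"
  then show "x \<in> ideal_gen_in A X" unfolding ideal_gen_in_def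
    by (intro CollectI exI[of _ "{x}"] exI[of _ "\<lambda>_. 1"]) (auto simp: subring_setD[OF assms])
qed

lemma (in graded) comps_mult_top:
  assumes h: "\<And>k. k > d \<Longrightarrow> comps h k = 0" and g: "\<And>k. k > e \<Longrightarrow> comps g k = 0"
  shows "k \<ge> d + e \<Longrightarrow> comps (h * g) k = (if k = d + e then comps h d * comps g e else 0)"
proof -
  assume k: "k \<ge> d + e"
  have "h = (\<Sum>i<Suc d. comps h i)" by (rule sum_comps) (use h in auto)
  then have "h * g = (\<Sum>i<Suc d. comps h i) * g" by (rule arg_cong)
  also have "\<dots> = (\<Sum>i<Suc d. comps h i * g)" by (rule sum_distrib_right)
  finally have "comps (h * g) k = comps (\<Sum>i<Suc d. comps h i * g) k" by (rule arg_cong)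
  also have "\<dots> = (\<Sum>i<Suc d. comps (comps h i * g) k)" by (rule comps_sum)
  also have "\<dots> = (\<Sum>i<Suc d. if i = d then comps h d * comps g (k - d) else 0)"
    using k g by (intro sum.cong refl) (auto simp: comps_mult_homogeneous[OF comps(2)])
  also have "\<dots> = comps h d * comps g (k - d)" by simp
  also have "\<dots> = (if k = d + e then comps h d * comps g e else 0)" using k g[of "k - d"] by auto
  finally show ?thesis .
qed

text \<open>Serves to lower degrees: a form of degree \<open>d\<close> in \<open>Q\<close> gets
  cofactors of degree \<open>d - \<delta> i\<close>, strictly below \<open>d\<close> once the
  \<open>\<delta> i\<close> are positive.\<close>

lemma (in graded) comps_in_homogeneous_ideal:
  fixes F :: "nat \<Rightarrow> 'b" and \<delta> :: "nat \<Rightarrow> nat"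
  assumes F: "\<And>i. i < n \<Longrightarrow> F i \<in> G (\<delta> i)" and q: "q \<in> ideal_gen_in UNIV (F ` {..<n})"
  shows "\<exists>u. comps q d = (\<Sum>i<n. F i * u i) \<and> (\<forall>i<n. if \<delta> i \<le> d then u i \<in> G (d - \<delta> i) else u i = 0)"
proof -
  obtain t where t: "q = (\<Sum>i<n. F i * t i)" using q by (auto simp: ideal_gen_in_UNIV_lessThan)
  let ?u = "\<lambda>i. if \<delta> i \<le> d then comps (t i) (d - \<delta> i) else 0"
  have "comps q d = (\<Sum>i<n. comps (F i * t i) d)" unfolding t by (rule comps_sum)
  also have "\<dots> = (\<Sum>i<n. F i * ?u i)"
    by (intro sum.cong) (auto simp: comps_mult_homogeneous[OF F])
  finally show ?thesis by (intro exI[of _ ?u]) (auto intro: comps(2))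
qed

section \<open>The filtration of S[Y] and independent leading forms\<close>

locale graded_prime_sequence = graded \<iota> G for \<iota> :: "'k::field \<Rightarrow> 'b::idom" and G :: "nat \<Rightarrow> 'b set" +
  fixes F :: "nat \<Rightarrow> 'b" and \<delta> :: "nat \<Rightarrow> nat" and n m :: nat
    and P :: "((nat \<Rightarrow>\<^sub>0 nat) \<Rightarrow>\<^sub>0 (nat \<Rightarrow>\<^sub>0 nat) \<Rightarrow>\<^sub>0 'k) set"
  assumes alg_closed: "alg_closed_field TYPE('k)"
    and F: "\<And>i. i < n \<Longrightarrow> F i \<in> G (\<delta> i)" and pos: "\<And>i. i < n \<Longrightarrow> \<delta> i > 0"
    and regular: "regular_sequence F n"
    and prime_Q: "prime_ideal_in UNIV (ideal_gen_in UNIV (F ` {..<n}))"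
    and prime_P: "prime_ideal_in (polys_over (polys_over UNIV n) m) P"
begin

definition "R = polys_over (polys_over (UNIV :: 'k set) n) m"
definition "\<Phi> = Poly_Mapping.map (mpoly_eval \<iota> F)"
definition "B = polys_over (UNIV :: 'b set) m"
definition "I = ideal_gen_in B (\<Phi> ` P)"
definition "Q = ideal_gen_in UNIV (F ` {..<n})"

lemma hom_\<iota>: "ring_hom_fun \<iota>" using graded by (simp add: graded_algebra_def)

lemma hom_\<Phi>: "ring_hom_fun \<Phi>"
  unfolding \<Phi>_def mpoly_eval_eq by (intro ring_hom_map ring_hom_eval_hom hom_\<iota>)

lemmas \<Phi> = ring_hom_funD[OF hom_\<Phi>] ring_hom_fun_sum[OF hom_\<Phi>]
lemmas Const = ring_hom_funD[OF ring_hom_Const] ring_hom_fun_sum[OF ring_hom_Const]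

lemma \<Phi>_gens:
  "\<Phi> (Const (Const a)) = Const (\<iota> a)" "\<Phi> (Const (Var i)) = Const (F i)" "\<Phi> (Var j) = Var j"
  unfolding \<Phi>_def mpoly_eval_eq
  by (simp_all add: Const_def Var_def eval_hom_single \<iota>_0 ring_hom_funD[OF ring_hom_eval_hom[OF hom_\<iota>]]
      monom_val_0 monom_val_def \<iota>_hom)

lemma subring_R: "subring_set R" and subring_B: "subring_set B"
  unfolding R_def B_def by (intro subring_polys_over subring_UNIV)+

lemmas R = subring_setD[OF subring_R]

lemma R_gens: "Const (Const a) \<in> R" "i < n \<Longrightarrow> Const (Var i) \<in> R" "j < m \<Longrightarrow> Var j \<in> R"
  unfolding R_def
  by (intro Const_in_polys_over Var_in_polys_over subring_polys_over subring_UNIV UNIV_I; assumption)+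

lemma R_induct [consumes 1, case_names const Xvar Yvar diff mult]:
  assumes "p \<in> R" "\<And>a. S (Const (Const a))" "\<And>i. i < n \<Longrightarrow> S (Const (Var i))" "\<And>j. j < m \<Longrightarrow> S (Var j)"
    "\<And>p q. p \<in> R \<Longrightarrow> q \<in> R \<Longrightarrow> S p \<Longrightarrow> S q \<Longrightarrow> S (p - q)" "\<And>p q. p \<in> R \<Longrightarrow> q \<in> R \<Longrightarrow> S p \<Longrightarrow> S q \<Longrightarrow> S (p * q)"
  shows "S p"
proof -
  have "S 1" using assms(2)[of 1] by (simp only: Const(1))
  then have "subring_set {p \<in> R. S p}"
    unfolding subring_set_def by (auto simp: assms R)
  then have "polys_over (polys_over UNIV n) m \<subseteq> {p \<in> R. S p}"
    by (rule polys_over_UNIV_subset_nested) (auto simp: assms R_gens)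
  then show ?thesis using assms(1) by (auto simp: R_def)
qed

lemma \<Phi>_in_B: "p \<in> R \<Longrightarrow> \<Phi> p \<in> B"
proof (induction rule: R_induct)
  case (diff p q) then show ?case by (simp add: \<Phi> subring_setD[OF subring_B])
next
  case (mult p q) then show ?case by (simp add: \<Phi> subring_setD[OF subring_B])
qed (auto simp: \<Phi>_gens B_def intro: Const_in_polys_over Var_in_polys_over subring_UNIV)

lemma P_subset: "P \<subseteq> R" and ideal_P: "ideal_in R P"
  using prime_P by (auto simp: prime_ideal_in_def ideal_in_def R_def)

lemma ideal_I: "ideal_in B I"
  unfolding I_def by (rule ideal_in_ideal_gen[OF subring_B]) (use P_subset \<Phi>_in_B in auto)

lemma ideal_Q: "ideal_in UNIV Q"
  using prime_Q by (simp add: prime_ideal_in_def Q_def)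

lemmas I_intros = ideal_I[unfolded ideal_in_def, THEN conjunct2, THEN conjunct2, THEN conjunct1, rule_format]
  ideal_in_diff[OF subring_B ideal_I] ideal_in_mult[OF ideal_I] ideal_in_sum[OF ideal_I]

lemma \<Phi>_P_in_I: "p \<in> P \<Longrightarrow> \<Phi> p \<in> I"
  using ideal_gen_in_superset[OF subring_B, of "\<Phi> ` P"] by (auto simp: I_def)

lemma Const_in_B: "Const s \<in> B"
  unfolding B_def by (intro Const_in_polys_over subring_UNIV UNIV_I)

inductive_set low :: "nat \<Rightarrow> ((nat \<Rightarrow>\<^sub>0 nat) \<Rightarrow>\<^sub>0 'b) set" for d :: nat where
  zero: "0 \<in> low d"
| step: "r \<in> R \<Longrightarrow> s \<in> G e \<Longrightarrow> e < d \<Longrightarrow> l \<in> low d \<Longrightarrow> \<Phi> r * Const s + l \<in> low d"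

lemma low_add: "x \<in> low d \<Longrightarrow> y \<in> low d \<Longrightarrow> x + y \<in> low d"
  by (induction rule: low.induct) (auto simp: add.assoc intro: low.step)

lemma low_sum: "(\<And>i. i \<in> J \<Longrightarrow> f i \<in> low d) \<Longrightarrow> sum f J \<in> low d"
  by (induction J rule: infinite_finite_induct) (auto intro: low_add low.zero)

lemma low_single: "r \<in> R \<Longrightarrow> s \<in> G e \<Longrightarrow> e < d \<Longrightarrow> \<Phi> r * Const s \<in> low d"
  using low.step[OF _ _ _ low.zero] by simp

lemma low_mono: "x \<in> low d \<Longrightarrow> d \<le> d' \<Longrightarrow> x \<in> low d'"
  by (induction rule: low.induct) (auto intro: low.intros)

lemma low_exhausts:
  assumes "f \<in> B"
  shows "\<exists>d. f \<in> low d"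
proof (rule poly_mapping_induct_single[of "\<lambda>f. \<exists>d. f \<in> low d"])
  show "\<exists>d. 0 \<in> low d" using low.zero by blast
  show "\<exists>d. x + y \<in> low d" if "\<exists>d. x \<in> low d" "\<exists>d. y \<in> low d" for x y
    using that low_add low_mono by (meson max.cobounded1 max.cobounded2)
  fix k assume k: "k \<in> Poly_Mapping.keys f"
  let ?a = "Poly_Mapping.lookup f k" and ?r = "Poly_Mapping.single k 1"
  have r: "?r \<in> R" unfolding R_def
    by (rule polys_over_single)
       (use k assms subring_setD[OF subring_polys_over[OF subring_UNIV]] in \<open>auto simp: polys_over_def B_def\<close>)
  obtain N where N: "\<And>d. d \<ge> N \<Longrightarrow> comps ?a d = 0" using comps_bound by blast
  \<comment> \<open>A monomial in Y with coefficient 1 is fixed by \<open>\<Phi>\<close>, so only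
    the coefficient from S has to be split into its components.\<close>
  have "\<Phi> ?r = Poly_Mapping.single k 1"
    unfolding \<Phi>_def mpoly_eval_eq by (simp add: ring_hom_funD[OF ring_hom_eval_hom[OF hom_\<iota>]])
  then have "Poly_Mapping.single k ?a = \<Phi> ?r * Const ?a"
    by (simp add: Const_def mult_single)
  also have "\<dots> = \<Phi> ?r * Const (\<Sum>e<N. comps ?a e)"
    by (rule arg_cong[OF sum_comps[OF N]])
  also have "\<dots> = (\<Sum>e<N. \<Phi> ?r * Const (comps ?a e))"
    by (simp add: Const sum_distrib_left)
  also have "\<dots> \<in> low N" by (intro low_sum low_single[OF r comps(2)]) auto
  finally show "\<exists>d. Poly_Mapping.single k ?a \<in> low d" by blast
qed

lemma low_SucD:
  "f \<in> low (Suc d) \<Longrightarrow> \<exists>l\<in>low d. \<exists>k s r. (\<forall>j<k. s j \<in> G d \<and> r j \<in> R) \<and>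
     f = l + (\<Sum>j<k::nat. \<Phi> (r j) * Const (s j))"
proof (induction rule: low.induct)
  case zero
  then show ?case by (intro bexI[of _ 0] exI[of _ 0]) (auto intro: low.zero)
next
  case (step r' s' e f)
  then obtain l k s r where *: "l \<in> low d" "\<And>j. j < k \<Longrightarrow> s j \<in> G d \<and> r j \<in> R"
    "f = l + (\<Sum>j<k::nat. \<Phi> (r j) * Const (s j))" by auto
  show ?case
  proof (cases "e < d")
    case True
    then have "\<Phi> r' * Const s' + l \<in> low d" using step * by (intro low.step)
    with * show ?thesis
      by (intro bexI[of _ "\<Phi> r' * Const s' + l"] exI[of _ k] exI[of _ s] exI[of _ r]) auto
  next
    case False
    then have "e = d" using step by simp
    with * step show ?thesis
      by (intro bexI[of _ l] exI[of _ "Suc k"] exI[of _ "s(k := s')"] exI[of _ "r(k := r')"])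
         (auto simp: less_Suc_eq algebra_simps)
  qed
qed

text \<open>Independence is over K and modulo \<open>Q\<close>, so it can be applied once the
  \<open>r j\<close> have become scalars. The coefficient \<open>\<rho>\<close> is exposed as a
  parameter because it is the one a K-point must not kill.\<close>

definition independent_top where
  "independent_top \<rho> d J s r \<longleftrightarrow> finite J \<and> (\<forall>j\<in>J. s j \<in> G d \<and> r j \<in> R) \<and> \<rho> \<in> r ` J \<and>
     (\<forall>c. (\<Sum>j\<in>J. \<iota> (c j) * s j) \<in> Q \<longrightarrow> (\<forall>j\<in>J. c j = 0))"

definition has_independent_top :: "((nat \<Rightarrow>\<^sub>0 nat) \<Rightarrow>\<^sub>0 (nat \<Rightarrow>\<^sub>0 nat) \<Rightarrow>\<^sub>0 'k) \<Rightarrow> ((nat \<Rightarrow>\<^sub>0 nat) \<Rightarrow>\<^sub>0 'b) \<Rightarrow> bool" where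
  "has_independent_top \<rho> f \<longleftrightarrow> (\<exists>d. \<exists>l\<in>low d. \<exists>J s r. independent_top \<rho> d (J::nat set) s r \<and>
     f - l - (\<Sum>j\<in>J. \<Phi> (r j) * Const (s j)) \<in> I)"

lemma has_independent_top_cong:
  assumes "has_independent_top \<rho> f" "g - f \<in> I"
  shows "has_independent_top \<rho> g"
proof -
  obtain d l J s r where *: "l \<in> low d" "independent_top \<rho> d (J::nat set) s r"
    "f - l - (\<Sum>j\<in>J. \<Phi> (r j) * Const (s j)) \<in> I"
    using assms(1) unfolding has_independent_top_def by blast
  have "g - l - (\<Sum>j\<in>J. \<Phi> (r j) * Const (s j)) = (g - f) + (f - l - (\<Sum>j\<in>J. \<Phi> (r j) * Const (s j)))"
    by simp
  then have "g - l - (\<Sum>j\<in>J. \<Phi> (r j) * Const (s j)) \<in> I"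
    using I_intros(1)[OF assms(2) *(3)] by (simp only:)
  with *(1,2) show ?thesis unfolding has_independent_top_def by blast
qed

text \<open>A dependence modulo \<open>Q\<close> eliminates one form \<open>s j\<close> at the price
  of terms in \<open>low d\<close>, so induction on the number of forms ends with either independent
  forms or all coefficients in \<open>P\<close>.\<close>

lemma independent_top_step:
  assumes IH: "\<And>l. l \<in> low d \<Longrightarrow> l \<in> I \<or> (\<exists>\<rho>\<in>R - P. has_independent_top \<rho> l)"
  shows "finite (J :: nat set) \<Longrightarrow> l \<in> low d \<Longrightarrow> (\<And>j. j \<in> J \<Longrightarrow> s j \<in> G d) \<Longrightarrow> (\<And>j. j \<in> J \<Longrightarrow> r j \<in> R) \<Longrightarrow>
    f = l + (\<Sum>j\<in>J. \<Phi> (r j) * Const (s j)) \<Longrightarrow> f \<in> I \<or> (\<exists>\<rho>\<in>R - P. has_independent_top \<rho> f)"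
proof (induction "card J" arbitrary: J l r rule: less_induct)
  case less
  note J = less.prems
  let ?\<Sigma> = "\<Sum>j\<in>J. \<Phi> (r j) * Const (s j)"
  consider "\<forall>j\<in>J. r j \<in> P"
    | j where "j \<in> J" "r j \<notin> P" "\<forall>c. (\<Sum>j\<in>J. \<iota> (c j) * s j) \<in> Q \<longrightarrow> (\<forall>j\<in>J. c j = 0)"
    | c j where "(\<Sum>j\<in>J. \<iota> (c j) * s j) \<in> Q" "j \<in> J" "c j \<noteq> 0"
    by blast
  then show ?case
  proof cases
    \<comment> \<open>The whole part of degree \<open>d\<close> lies in \<open>I\<close>, and
      \<open>IH\<close> takes over one filtration step below.\<close>
    case 1
    then have "?\<Sigma> \<in> I"
      using I_intros(3)[OF Const_in_B \<Phi>_P_in_I] by (intro I_intros(4)) (auto simp: mult.commute)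
    then have fl: "f - l \<in> I" using J(5) by simp
    show ?thesis using IH[OF J(2)]
    proof
      assume "l \<in> I"
      then have "f - l + l \<in> I" by (rule I_intros(1)[OF fl])
      then show ?thesis by simp
    qed (use has_independent_top_cong fl in blast)
  next
    case 2
    have "f - l - ?\<Sigma> \<in> I" using J(5) ideal_I by (simp add: ideal_in_def)
    moreover have "independent_top (r j) d J s r" unfolding independent_top_def using 2 J by blast
    ultimately have "has_independent_top (r j) f" unfolding has_independent_top_def using J(2) by blast
    then show ?thesis using 2 J(4) by blast
  next
    case 3
    \<comment> \<open>The dependence, divided by \<open>c j\<close>, is solved for
      \<open>s j\<close>; \<open>q\<close> is the resulting error, a form of degree \<open>d\<close>
      in \<open>Q\<close>.\<close>
    define c' where "c' i = - (c i / c j)" for i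
    define q where "q = \<iota> (1 / c j) * (\<Sum>i\<in>J. \<iota> (c i) * s i)"
    have qQ: "q \<in> Q" unfolding q_def using ideal_in_mult[OF ideal_Q _ 3(1)] by simp
    have qG: "q \<in> G d" unfolding q_def using J(3) by (intro G_intros(3) G_sum)
    have q: "q = s j - (\<Sum>i\<in>J - {j}. \<iota> (c' i) * s i)"
    proof -
      have "q = (\<Sum>i\<in>J. \<iota> (1 / c j * c i) * s i)"
        unfolding q_def by (simp only: sum_distrib_left \<iota>_hom(3) mult.assoc)
      also have "\<dots> = \<iota> (1 / c j * c j) * s j + (\<Sum>i\<in>J - {j}. \<iota> (1 / c j * c i) * s i)"
        by (rule sum.remove[OF J(1) 3(2)])
      also have "\<iota> (1 / c j * c j) = 1" using 3(3) \<iota>_hom(1) by simp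
      also have "(\<Sum>i\<in>J - {j}. \<iota> (1 / c j * c i) * s i) = - (\<Sum>i\<in>J - {j}. \<iota> (c' i) * s i)"
        by (simp add: c'_def \<iota>_uminus sum_negf)
      finally show ?thesis by simp
    qed
    obtain u where u: "comps q d = (\<Sum>i<n. F i * u i)"
        "\<forall>i<n. if \<delta> i \<le> d then u i \<in> G (d - \<delta> i) else u i = 0"
      using comps_in_homogeneous_ideal[OF F qQ[unfolded Q_def]] by blast
    have sj: "s j = (\<Sum>i\<in>J - {j}. \<iota> (c' i) * s i) + (\<Sum>i<n. F i * u i)"
      using q u(1) comps_homogeneous[OF qG, of d] by simp
    \<comment> \<open>Each \<open>F i\<close> occurring in \<open>q\<close> is absorbed into the
      coefficient as the variable \<open>Const (Var i)\<close> of \<open>R\<close>. What remains is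
      \<open>u i\<close>, of degree below \<open>d\<close>, so the error joins the lower
      part.\<close>
    define l' where "l' = l + (\<Sum>i<n. \<Phi> (r j * Const (Var i)) * Const (u i))"
    define r' where "r' i = r i + r j * Const (Const (c' i))" for i
    have "l' \<in> low d" unfolding l'_def
    proof (intro low_add J(2) low_sum)
      fix i assume "i \<in> {..<n}"
      then have i: "i < n" by simp
      show "\<Phi> (r j * Const (Var i)) * Const (u i) \<in> low d"
      proof (cases "\<delta> i \<le> d")
        case True
        show ?thesis by (rule low_single[of _ _ "d - \<delta> i"])
          (use u(2) i pos[OF i] True J(4)[OF 3(2)] in \<open>auto intro!: R R_gens\<close>)
      next
        case False
        then have "u i = 0" using u(2) i by auto
        then show ?thesis by (simp add: Const low.zero)
      qed
    qed
    moreover have "f = l' + (\<Sum>i\<in>J - {j}. \<Phi> (r' i) * Const (s i))"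
    proof -
      have "\<Phi> (r j) * Const (s j) = (\<Sum>i\<in>J - {j}. \<Phi> (r j) * (Const (\<iota> (c' i)) * Const (s i)))
          + (\<Sum>i<n. \<Phi> (r j) * (Const (F i) * Const (u i)))"
        unfolding sj by (simp add: Const distrib_left sum_distrib_left)
      moreover have "?\<Sigma> = \<Phi> (r j) * Const (s j) + (\<Sum>i\<in>J - {j}. \<Phi> (r i) * Const (s i))"
        by (rule sum.remove[OF J(1) 3(2)])
      ultimately show ?thesis
        unfolding J(5) l'_def r'_def
        by (simp add: \<Phi> \<Phi>_gens distrib_right sum.distrib mult.assoc)
    qed
    moreover have "card (J - {j}) < card J" using J(1) 3(2) by (rule card_Diff1_less)
    moreover have "r' i \<in> R" if "i \<in> J - {j}" for i
      using that J(4) 3(2) by (auto simp: r'_def intro!: R R_gens)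
    ultimately show ?thesis using less.hyps[of "J - {j}" l' r'] J(1,3) by blast
  qed
qed

lemma low_imp_independent_top: "f \<in> low d \<Longrightarrow> f \<in> I \<or> (\<exists>\<rho>\<in>R - P. has_independent_top \<rho> f)"
proof (induction d arbitrary: f)
  case 0
  then have "f = 0" by cases auto
  then show ?case using ideal_I by (simp add: ideal_in_def)
next
  case (Suc d)
  from low_SucD[OF Suc.prems] obtain l k s r where *: "l \<in> low d" "\<And>j. j < k \<Longrightarrow> s j \<in> G d \<and> r j \<in> R"
    "f = l + (\<Sum>j<k::nat. \<Phi> (r j) * Const (s j))" by blast
  show ?case by (rule independent_top_step[OF Suc.IH, where J = "{..<k}" and l = l and s = s and r = r]) (use * in auto)
qed

end

section \<open>Evaluation at a K-point\<close>

locale specialization = graded_prime_sequence \<iota> G F \<delta> n m P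
  for \<iota> :: "'k::field \<Rightarrow> 'b::idom" and G F \<delta> n m P +
  fixes \<phi> :: "((nat \<Rightarrow>\<^sub>0 nat) \<Rightarrow>\<^sub>0 (nat \<Rightarrow>\<^sub>0 nat) \<Rightarrow>\<^sub>0 'k) \<Rightarrow> 'k"
  assumes hom_\<phi>: "hom_on R \<phi>" and \<phi>_const: "\<And>a. \<phi> (Const (Const a)) = a"
    and \<phi>_P: "\<And>p. p \<in> P \<Longrightarrow> \<phi> p = 0"
begin

text \<open>Only the Y_j are evaluated. The X_i have already become the elements \<open>F i\<close>
  of S, so their values at the point can be imposed only modulo \<open>N\<close>.\<close>

definition "\<sigma> = eval_hom id (\<lambda>j. \<iota> (\<phi> (Var j)))"
definition "N = ideal_gen_in UNIV ((\<lambda>i. F i - \<iota> (\<phi> (Const (Var i)))) ` {..<n})"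

lemma hom_\<sigma>: "ring_hom_fun \<sigma>"
  unfolding \<sigma>_def by (rule ring_hom_eval_hom) (simp add: ring_hom_fun_def)

lemmas \<sigma> = ring_hom_funD[OF hom_\<sigma>] ring_hom_fun_sum[OF hom_\<sigma>]

lemma \<sigma>_gens: "\<sigma> (Const s) = s" "\<sigma> (Var j) = \<iota> (\<phi> (Var j))"
  by (simp_all add: \<sigma>_def Const_def Var_def eval_hom_single monom_val_0 monom_val_def)

lemma ideal_N: "ideal_in UNIV N"
  unfolding N_def by (intro ideal_in_ideal_gen subring_UNIV) simp

lemma N_intros: "0 \<in> N" "x \<in> N \<Longrightarrow> y \<in> N \<Longrightarrow> x + y \<in> N" "x \<in> N \<Longrightarrow> y \<in> N \<Longrightarrow> x - y \<in> N"
  "x \<in> N \<Longrightarrow> a * x \<in> N" "x \<in> N \<Longrightarrow> x * a \<in> N"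
  using ideal_N ideal_in_diff[OF subring_UNIV ideal_N, of x y] by (auto simp: ideal_in_def mult.commute)

lemma N_mult_cong:
  assumes "x - x' \<in> N" "y - y' \<in> N"
  shows "x * y - x' * y' \<in> N"
proof -
  have "x * y - x' * y' = x * (y - y') + (x - x') * y'" by (simp add: algebra_simps)
  then show ?thesis using N_intros(2)[OF N_intros(4)[OF assms(2)] N_intros(5)[OF assms(1)]] by simp
qed

text \<open>Both maps respect differences and products modulo \<open>N\<close>, and they agree on
  constants and on both kinds of variables; for X_i the difference is a generator of
  \<open>N\<close>.\<close>

lemma \<sigma>_\<Phi>: "p \<in> R \<Longrightarrow> \<sigma> (\<Phi> p) - \<iota> (\<phi> p) \<in> N"
proof (induction rule: R_induct)
  case (Xvar i)
  then show ?case
    using ideal_gen_in_superset[OF subring_UNIV, of "(\<lambda>i. F i - \<iota> (\<phi> (Const (Var i)))) ` {..<n}"]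
    by (auto simp: \<Phi>_gens \<sigma>_gens N_def)
next
  case (diff p q)
  have "\<phi> (p - q) + \<phi> q = \<phi> p" using hom_onD(2)[OF hom_\<phi>, of "p - q" q] diff R by simp
  then have "\<iota> (\<phi> (p - q)) = \<iota> (\<phi> p) - \<iota> (\<phi> q)" using \<iota>_hom(2) by (metis add_diff_cancel_right')
  then have "\<sigma> (\<Phi> (p - q)) - \<iota> (\<phi> (p - q)) = (\<sigma> (\<Phi> p) - \<iota> (\<phi> p)) - (\<sigma> (\<Phi> q) - \<iota> (\<phi> q))"
    by (simp add: \<Phi> \<sigma>)
  then show ?case using N_intros(3)[OF diff(3,4)] by (simp only:)
next
  case (mult p q)
  then show ?case using N_mult_cong[OF mult(3,4)] by (simp add: \<Phi> \<sigma> hom_onD(3)[OF hom_\<phi>] \<iota>_hom)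
qed (auto simp: \<Phi>_gens \<sigma>_gens \<phi>_const N_intros)

lemma \<sigma>_I: "f \<in> I \<Longrightarrow> \<sigma> f \<in> N"
proof -
  have "ideal_in B {f \<in> B. \<sigma> f \<in> N}"
    using subring_setD[OF subring_B] by (auto simp: ideal_in_def \<sigma> N_intros)
  moreover have "\<Phi> ` P \<subseteq> {f \<in> B. \<sigma> f \<in> N}"
    using P_subset \<Phi>_in_B \<sigma>_\<Phi> \<phi>_P by (force simp: \<iota>_0)
  ultimately show "f \<in> I \<Longrightarrow> \<sigma> f \<in> N" unfolding I_def using ideal_gen_in_least by blast
qed

lemma \<sigma>_term: "r \<in> R \<Longrightarrow> \<sigma> (\<Phi> r * Const s) - \<iota> (\<phi> r) * s \<in> N"
  using N_intros(5)[OF \<sigma>_\<Phi>, of r s] by (simp add: \<sigma> \<sigma>_gens left_diff_distrib)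

text \<open>Modulo \<open>N\<close> the coefficients from \<open>R\<close> become scalars, so the
  filtration turns into the true degree. Passing to \<open>h\<close> is necessary since
  \<open>\<Phi> r\<close> itself may have components of any degree.\<close>

lemma \<sigma>_low: "l \<in> low d \<Longrightarrow> \<exists>h. \<sigma> l - h \<in> N \<and> (\<forall>k\<ge>d. comps h k = 0)"
proof (induction rule: low.induct)
  case zero
  then show ?case by (intro exI[of _ 0]) (simp add: \<sigma> N_intros comps_0)
next
  case (step r s e l)
  then obtain h where h: "\<sigma> l - h \<in> N" "\<forall>k\<ge>d. comps h k = 0" by blast
  have "\<iota> (\<phi> r) * s \<in> G e" using step by (intro G_intros)
  from comps_homogeneous[OF this] have "\<forall>k\<ge>d. comps (\<iota> (\<phi> r) * s + h) k = 0"
    using h(2) step by (auto simp: comps_add)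
  moreover have "\<sigma> (\<Phi> r * Const s + l) - (\<iota> (\<phi> r) * s + h)
      = (\<sigma> (\<Phi> r * Const s) - \<iota> (\<phi> r) * s) + (\<sigma> l - h)" by (simp add: \<sigma>)
  then have "\<sigma> (\<Phi> r * Const s + l) - (\<iota> (\<phi> r) * s + h) \<in> N"
    using N_intros(2)[OF \<sigma>_term[OF step(1), of s] h(1)] by (simp only:)
  ultimately show ?case by blast
qed

text \<open>The top becomes the K-combination of the \<open>s j\<close> with coefficients
  \<open>\<phi> (r j)\<close>. One of these is \<open>\<phi> \<rho>\<close>, which is nonzero, so
  independence keeps the combination outside \<open>Q\<close>.\<close>

lemma \<sigma>_independent_top:
  assumes "has_independent_top \<rho> f" "\<phi> \<rho> \<noteq> 0"
  shows "\<exists>h d. \<sigma> f - h \<in> N \<and> (\<forall>k>d. comps h k = 0) \<and> comps h d \<notin> Q"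
proof -
  obtain d l J s r where *: "l \<in> low d" "\<And>j. j \<in> J \<Longrightarrow> s j \<in> G d" "\<And>j. j \<in> J \<Longrightarrow> r j \<in> R"
    "f - l - (\<Sum>j\<in>J. \<Phi> (r j) * Const (s j)) \<in> I" "\<rho> \<in> r ` (J :: nat set)"
    "\<And>c. (\<Sum>j\<in>J. \<iota> (c j) * s j) \<in> Q \<Longrightarrow> (\<forall>j\<in>J. c j = 0)"
    using assms(1) unfolding has_independent_top_def independent_top_def by (elim exE bexE conjE) blast
  obtain h where h: "\<sigma> l - h \<in> N" "\<forall>k\<ge>d. comps h k = 0" using \<sigma>_low[OF *(1)] by blast
  let ?t = "\<Sum>j\<in>J. \<iota> (\<phi> (r j)) * s j"
  have t: "?t \<in> G d" using *(2) by (intro G_sum G_intros)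
  have "?t \<notin> Q"
  proof
    assume "?t \<in> Q"
    then have "\<forall>j\<in>J. \<phi> (r j) = 0" by (rule *(6))
    then show False using *(5) assms(2) by auto
  qed
  then have "comps (?t + h) d \<notin> Q" using h(2) by (simp add: comps_add comps_homogeneous[OF t])
  moreover have "\<forall>k>d. comps (?t + h) k = 0" using h(2) by (simp add: comps_add comps_homogeneous[OF t])
  moreover have "\<sigma> f - (?t + h) \<in> N"
  proof -
    have "\<sigma> f - (?t + h) = \<sigma> (f - l - (\<Sum>j\<in>J. \<Phi> (r j) * Const (s j))) + ((\<sigma> l - h)
        + (\<Sum>j\<in>J. \<sigma> (\<Phi> (r j) * Const (s j)) - \<iota> (\<phi> (r j)) * s j))"
      by (simp add: \<sigma> sum_subtractf)
    also have "\<dots> \<in> N"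
      by (intro N_intros(2) \<sigma>_I *(4) h(1) ideal_in_sum[OF ideal_N] \<sigma>_term *(3))
    finally show ?thesis .
  qed
  ultimately show ?thesis by blast
qed

lemma leading_form_N:
  assumes "h \<in> N" "\<And>k. k > d \<Longrightarrow> comps h k = 0"
  shows "comps h d \<in> Q"
  unfolding Q_def
  by (rule leading_form_shifted[OF F pos _ assms(1)[unfolded N_def] assms(2)])
     (use regular in \<open>auto simp: regular_sequence_def\<close>)

text \<open>If the product were in \<open>I\<close>, then \<open>h * h'\<close> would be in
  \<open>N\<close> and its leading form in \<open>Q\<close>. That form is the product of two forms
  outside the prime \<open>Q\<close>.\<close>

lemma independent_top_mult_notin:
  assumes "has_independent_top \<rho> f" "has_independent_top \<rho>' g" "\<phi> \<rho> \<noteq> 0" "\<phi> \<rho>' \<noteq> 0"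
  shows "f * g \<notin> I"
proof
  assume "f * g \<in> I"
  obtain h d where h: "\<sigma> f - h \<in> N" "\<And>k. k > d \<Longrightarrow> comps h k = 0" "comps h d \<notin> Q"
    using \<sigma>_independent_top[OF assms(1,3)] by blast
  obtain h' e where h': "\<sigma> g - h' \<in> N" "\<And>k. k > e \<Longrightarrow> comps h' k = 0" "comps h' e \<notin> Q"
    using \<sigma>_independent_top[OF assms(2,4)] by blast
  have "h * h' = \<sigma> (f * g) - (\<sigma> f * \<sigma> g - h * h')" by (simp add: \<sigma>)
  also have "\<dots> \<in> N" by (intro N_intros(3) \<sigma>_I N_mult_cong h(1) h'(1)) fact
  finally have "h * h' \<in> N" .
  have top: "comps (h * h') k = (if k = d + e then comps h d * comps h' e else 0)" if "k \<ge> d + e" for k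
    using that by (intro comps_mult_top) (use h(2) h'(2) in auto)
  have "comps (h * h') (d + e) \<in> Q" by (rule leading_form_N) (use \<open>h * h' \<in> N\<close> top in auto)
  then have "comps h d * comps h' e \<in> Q" using top by simp
  then show False using h(3) h'(3) prime_Q by (auto simp: prime_ideal_in_def Q_def)
qed

end

section \<open>Primality of the extended ideal\<close>

context graded_prime_sequence
begin

lemma specialization_exists:
  assumes "\<rho> \<in> R - P"
  shows "\<exists>\<phi>. specialization \<iota> G F \<delta> n m P \<phi> \<and> \<phi> \<rho> \<noteq> 0"
proof -
  let ?\<kappa> = "\<lambda>a::'k. Const (Const a) :: (nat \<Rightarrow>\<^sub>0 nat) \<Rightarrow>\<^sub>0 (nat \<Rightarrow>\<^sub>0 nat) \<Rightarrow>\<^sub>0 'k"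
  let ?cs = "map (\<lambda>i. Const (Var i)) [0..<n] @ map Var [0..<m] :: ((nat \<Rightarrow>\<^sub>0 nat) \<Rightarrow>\<^sub>0 (nat \<Rightarrow>\<^sub>0 nat) \<Rightarrow>\<^sub>0 'k) list"
  have \<kappa>: "ring_hom_fun ?\<kappa>" by (auto simp: ring_hom_fun_def Const)
  have sub: "subring_set (range ?\<kappa>)"
    unfolding subring_set_def by (auto simp: Const[symmetric])
  note gens = adjoin_list_gens[OF sub, of ?cs] adjoin_list_superset[OF sub, of ?cs]
  \<comment> \<open>\<open>R\<close> is presented as a finitely generated extension of the scalars,
    the shape to which the Nullstellensatz applies.\<close>
  have R_eq: "adjoin_list (range ?\<kappa>) ?cs = R"
  proof
    show "adjoin_list (range ?\<kappa>) ?cs \<subseteq> R"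
      by (rule adjoin_list_subset[OF subring_R]) (auto intro: R_gens)
    show "R \<subseteq> adjoin_list (range ?\<kappa>) ?cs" unfolding R_def
      by (rule polys_over_UNIV_subset_nested[OF subring_adjoin_list[OF sub]]) (use gens in auto)
  qed
  obtain \<phi> where "hom_on R \<phi>" "\<forall>k. \<phi> (?\<kappa> k) = k" "\<forall>x\<in>P. \<phi> x = 0" "\<phi> \<rho> \<noteq> 0"
    using nullstellensatz[OF alg_closed \<kappa>, of ?cs P \<rho>] assms prime_P unfolding R_eq R_def[symmetric] by blast
  then show ?thesis
    by (intro exI[of _ \<phi>] conjI specialization.intro specialization_axioms.intro graded_prime_sequence_axioms) auto
qed

lemma prime_or_unit_I: "prime_ideal_in B I \<or> I = B"
proof -
  have "f \<in> I \<or> g \<in> I" if f: "f \<in> B" and g: "g \<in> B" and fg: "f * g \<in> I" for f g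
  proof (rule ccontr)
    assume "\<not> (f \<in> I \<or> g \<in> I)"
    then obtain \<rho> \<rho>' where \<rho>: "\<rho> \<in> R - P" "has_independent_top \<rho> f" "\<rho>' \<in> R - P" "has_independent_top \<rho>' g"
      using low_exhausts[OF f] low_exhausts[OF g] low_imp_independent_top by metis
    \<comment> \<open>A point where the product survives serves both factors at once; two separate
      points would give two different ideals \<open>N\<close>.\<close>
    then have "\<rho> * \<rho>' \<in> R - P" using prime_P R by (auto simp: prime_ideal_in_def R_def[symmetric])
    then obtain \<phi> where s: "specialization \<iota> G F \<delta> n m P \<phi>" and nz: "\<phi> (\<rho> * \<rho>') \<noteq> 0"
      using specialization_exists by blast
    have "\<phi> (\<rho> * \<rho>') = \<phi> \<rho> * \<phi> \<rho>'"
      using hom_onD(3)[OF specialization.hom_\<phi>[OF s]] \<rho> by simp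
    then show False using specialization.independent_top_mult_notin[OF s \<rho>(2,4)] nz fg by auto
  qed
  then show ?thesis using ideal_I by (auto simp: prime_ideal_in_def)
qed

end

theorem theorem5p12:
  fixes \<iota> :: "'k::field \<Rightarrow> 'b::idom"
    and G :: "nat \<Rightarrow> 'b set"
    and F :: "nat \<Rightarrow> 'b"
    and n :: nat
  assumes "alg_closed_field TYPE('k)"
    and "graded_algebra \<iota> G"
    and "\<forall>i<n. \<exists>d>0. F i \<in> G d"
    and "regular_sequence F n"
    and "prime_ideal_in UNIV (ideal_gen_in UNIV (F ` {..<n}))"
  shows "stable_prime_ext_prop (polys_over UNIV n) (mpoly_eval \<iota> F)"
  unfolding stable_prime_ext_prop_def prime_ext_prop_def
proof (intro allI impI)
  fix m P assume P: "prime_ideal_in (polys_over (polys_over (UNIV :: 'k set) n) m) P"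
  obtain \<delta> where \<delta>: "\<And>i. i < n \<Longrightarrow> \<delta> i > 0 \<and> F i \<in> G (\<delta> i)" using assms(3) by metis
  interpret graded_prime_sequence \<iota> G F \<delta> n m P
    by unfold_locales (use assms \<delta> P in auto)
  show "prime_ideal_in (polys_over UNIV m) (ideal_gen_in (polys_over UNIV m) (Poly_Mapping.map (mpoly_eval \<iota> F) ` P)) \<or>
    ideal_gen_in (polys_over UNIV m) (Poly_Mapping.map (mpoly_eval \<iota> F) ` P) = polys_over UNIV m"
    using prime_or_unit_I unfolding I_def B_def \<Phi>_def .
qed

end
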